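(* Let $\nu>0$ and let $f,g\in L^2(\mathbb{R},\mathbb{H})$. Then $$\langle \mathcal{B}^S_{\mathbb{H}}(f),\mathcal{B}^S_{\mathbb{H}}(g)\rangle_{\mathcal{F}^{2,\nu}_{Slice}(\mathbb{H})}=\langle f,g\rangle_{L^2(\mathbb{R},\mathbb{H})},$$ where $\mathcal{B}^S_{\mathbb{H}}$ is the quaternionic Segal-Bargmann transform with parameter $\nu$.
   Context: $\mathbb{H}$ is the algebra of real quaternions, with conjugation $\bar q$ and modulus $|q|=\sqrt{q\bar q}$, and $\mathbb{S}=\{q\in\mathbb{H}: q^2=-1\}$. For $I\in\mathbb{S}$, $\mathbb{C}_I=\mathbb{R}+\mathbb{R}I\subset\mathbb{H}$. A real differentiable function $f:\mathbb{H}\to\mathbb{H}$ is (left) slice regular, $f\in\mathcal{SR}(\mathbb{H})$, if for every $I\in\mathbb{S}$ the restriction $f_I=f|_{\mathbb{C}_I}$ has continuous partial derivatives in $x,y$ (where $q=x+Iy$) and $\frac12\left(\frac{\partial}{\partial x}+I\frac{\partial}{\partial y}\right)f_I(x+Iy)=0$ on $\mathbb{C}_I$. $L^2(\mathbb{R},\mathbb{H})$ is the right $\mathbb{H}$-vector space of square integrable $\mathbb{H}$-valued functions on $\mathbb{R}$ with inner product $\langle\psi,\phi\rangle=\int_{\mathbb{R}}\overline{\phi(t)}\psi(t)\,dt$. For $\nu>0$ and a given $I\in\mathbb{S}$, the slice hyperholomorphic Fock space is $$\mathcal{F}^{2,\nu}_{Slice}(\mathbb{H})=\Big\{f\in\mathcal{SR}(\mathbb{H}):\int_{\mathbb{C}_I}|f_I(p)|^2e^{-\nu|p|^2}d\lambda_I(p)<\infty\Big\},$$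 with $d\lambda_I(p)=dx\,dy$ for $p=x+yI$, and inner product $\langle f,g\rangle=\int_{\mathbb{C}_I}\overline{g_I(q)}f_I(q)e^{-\nu|q|^2}d\lambda_I(q)$; this Hilbert space does not depend on the choice of $I$. The quaternionic Segal-Bargmann transform with parameter $\nu$ is $$\mathcal{B}^S_{\mathbb{H}}(\varphi)(q)=\int_{\mathbb{R}}\mathcal{A}^S_{\mathbb{H}}(q,x)\varphi(x)\,dx,\qquad \mathcal{A}^S_{\mathbb{H}}(q,x)=\left(\frac{\nu}{\pi}\right)^{3/4}e^{-\frac{\nu}{2}(q^2+x^2)+\nu\sqrt2\,qx},\quad q\in\mathbb{H},\ x\in\mathbb{R}.$$ *)

theory Defs
  imports "HOL-Analysis.Analysis"
begin

section \<open>Real quaternions\<close>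

text \<open>\<open>Quat a b c d\<close> stands for a + b i + c j + d k.\<close>

datatype quat = Quat (QRe: real) (QI: real) (QJ: real) (QK: real)

lemma quat_eq_iff:
  "p = q \<longleftrightarrow> QRe p = QRe q \<and> QI p = QI q \<and> QJ p = QJ q \<and> QK p = QK q"
  by (cases p; cases q) simp

instantiation quat :: ab_group_add
begin

definition "0 = Quat 0 0 0 0"
definition "p + q = Quat (QRe p + QRe q) (QI p + QI q) (QJ p + QJ q) (QK p + QK q)"
definition "- q = Quat (- QRe q) (- QI q) (- QJ q) (- QK q)"
definition "p - q = Quat (QRe p - QRe q) (QI p - QI q) (QJ p - QJ q) (QK p - QK q)"

instance
  by standard
    (simp_all add: zero_quat_def plus_quat_def uminus_quat_def minus_quat_def)

end

lemma quat_add_simps [simp]: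
  "QRe 0 = 0" "QI 0 = 0" "QJ 0 = 0" "QK 0 = 0"
  "QRe (p + q) = QRe p + QRe q" "QI (p + q) = QI p + QI q"
  "QJ (p + q) = QJ p + QJ q" "QK (p + q) = QK p + QK q"
  "QRe (- q) = - QRe q" "QI (- q) = - QI q" "QJ (- q) = - QJ q" "QK (- q) = - QK q"
  "QRe (p - q) = QRe p - QRe q" "QI (p - q) = QI p - QI q"
  "QJ (p - q) = QJ p - QJ q" "QK (p - q) = QK p - QK q"
  by (simp_all add: zero_quat_def plus_quat_def uminus_quat_def minus_quat_def)

instantiation quat :: ring_1
begin

definition "1 = Quat 1 0 0 0"

definition "p * q = Quat
  (QRe p * QRe q - QI p * QI q - QJ p * QJ q - QK p * QK q)
  (QRe p * QI q + QI p * QRe q + QJ p * QK q - QK p * QJ q)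
  (QRe p * QJ q - QI p * QK q + QJ p * QRe q + QK p * QI q)
  (QRe p * QK q + QI p * QJ q - QJ p * QI q + QK p * QRe q)"

instance
  by standard (simp_all add: quat_eq_iff one_quat_def times_quat_def algebra_simps)

end

lemma quat_mult_simps [simp]:
  "QRe 1 = 1" "QI 1 = 0" "QJ 1 = 0" "QK 1 = 0"
  "QRe (p * q) = QRe p * QRe q - QI p * QI q - QJ p * QJ q - QK p * QK q"
  "QI (p * q) = QRe p * QI q + QI p * QRe q + QJ p * QK q - QK p * QJ q"
  "QJ (p * q) = QRe p * QJ q - QI p * QK q + QJ p * QRe q + QK p * QI q"
  "QK (p * q) = QRe p * QK q + QI p * QJ q - QJ p * QI q + QK p * QRe q"
  by (simp_all add: one_quat_def times_quat_def)

instantiation quat :: real_algebra_1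
begin

definition "scaleR r q = Quat (r * QRe q) (r * QI q) (r * QJ q) (r * QK q)"

instance
  by standard (simp_all add: quat_eq_iff scaleR_quat_def algebra_simps)

end

lemma quat_scaleR_simps [simp]:
  "QRe (r *\<^sub>R q) = r * QRe q" "QI (r *\<^sub>R q) = r * QI q"
  "QJ (r *\<^sub>R q) = r * QJ q" "QK (r *\<^sub>R q) = r * QK q"
  by (simp_all add: scaleR_quat_def)

lemma quat_of_real_simps [simp]:
  "QRe (of_real r) = r" "QI (of_real r) = 0" "QJ (of_real r) = 0" "QK (of_real r) = 0"
  by (simp_all add: of_real_def)

definition qcnj :: "quat \<Rightarrow> quat"
  where "qcnj q = Quat (QRe q) (- QI q) (- QJ q) (- QK q)"

lemma qcnj_simps [simp]:
  "QRe (qcnj q) = QRe q" "QI (qcnj q) = - QI q" "QJ (qcnj q) = - QJ q" "QK (qcnj q) = - QK q"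
  by (simp_all add: qcnj_def)

lemma quat_sum_squares_eq_0:
  "(QRe q)\<^sup>2 + (QI q)\<^sup>2 + (QJ q)\<^sup>2 + (QK q)\<^sup>2 = 0 \<longleftrightarrow> q = 0"
proof
  assume h: "(QRe q)\<^sup>2 + (QI q)\<^sup>2 + (QJ q)\<^sup>2 + (QK q)\<^sup>2 = 0"
  have "(QRe q)\<^sup>2 = 0 \<and> (QI q)\<^sup>2 = 0 \<and> (QJ q)\<^sup>2 = 0 \<and> (QK q)\<^sup>2 = 0"
    using h zero_le_power2[of "QRe q"] zero_le_power2[of "QI q"]
      zero_le_power2[of "QJ q"] zero_le_power2[of "QK q"] by linarith
  then show "q = 0" by (simp add: quat_eq_iff)
qed simp

instantiation quat :: inverse
begin

definition "inverse q = (1 / ((QRe q)\<^sup>2 + (QI q)\<^sup>2 + (QJ q)\<^sup>2 + (QK q)\<^sup>2)) *\<^sub>R qcnj q"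
definition "p div q = p * inverse q" for p q :: quat

instance ..

end

instance quat :: division_ring
proof
  fix p q :: quat
  show "p / q = p * inverse q" by (fact divide_quat_def)
  show "inverse (0 :: quat) = 0" by (simp add: inverse_quat_def quat_eq_iff)
  define s where "s = (QRe q)\<^sup>2 + (QI q)\<^sup>2 + (QJ q)\<^sup>2 + (QK q)\<^sup>2"
  have "qcnj q * q = s *\<^sub>R 1" "q * qcnj q = s *\<^sub>R 1"
    by (simp_all add: quat_eq_iff s_def power2_eq_square)
  moreover assume "q \<noteq> 0"
  then have "s \<noteq> 0" by (simp add: s_def quat_sum_squares_eq_0)
  ultimately show "inverse q * q = 1" "q * inverse q = 1"
    by (simp_all add: inverse_quat_def s_def [symmetric])
qed

instantiation quat :: real_inner
begin

definition "inner p q = QRe p * QRe q + QI p * QI q + QJ p * QJ q + QK p * QK q"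
definition "norm q = sqrt ((QRe q)\<^sup>2 + (QI q)\<^sup>2 + (QJ q)\<^sup>2 + (QK q)\<^sup>2)"
definition "sgn q = q /\<^sub>R norm q" for q :: quat
definition "dist p q = norm (p - q)" for p q :: quat
definition [code del]:
  "(uniformity :: (quat \<times> quat) filter) = (INF e\<in>{0 <..}. principal {(x, y). dist x y < e})"
definition [code del]:
  "open (U :: quat set) \<longleftrightarrow> (\<forall>x\<in>U. eventually (\<lambda>(x', y). x' = x \<longrightarrow> y \<in> U) uniformity)"

instance
proof
  fix p q u :: quat and r :: real
  show "dist p q = norm (p - q)" by (fact dist_quat_def)
  show "sgn q = q /\<^sub>R norm q" by (fact sgn_quat_def)
  show "(uniformity :: (quat \<times> quat) filter) = (INF e\<in>{0 <..}. principal {(x, y). dist x y < e})"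
    by (fact uniformity_quat_def)
  show "open U \<longleftrightarrow> (\<forall>x\<in>U. eventually (\<lambda>(x', y). x' = x \<longrightarrow> y \<in> U) uniformity)"
    for U :: "quat set" by (fact open_quat_def)
  show "inner p q = inner q p" by (simp add: inner_quat_def mult.commute)
  show "inner (p + q) u = inner p u + inner q u" by (simp add: inner_quat_def algebra_simps)
  show "inner (r *\<^sub>R p) q = r * inner p q" by (simp add: inner_quat_def algebra_simps)
  show "0 \<le> inner p p" by (simp add: inner_quat_def)
  show "inner p p = 0 \<longleftrightarrow> p = 0"
    using quat_sum_squares_eq_0[of p] by (simp add: inner_quat_def power2_eq_square)
  show "norm p = sqrt (inner p p)" by (simp add: norm_quat_def inner_quat_def power2_eq_square)
qed

end

text \<open>The norm is the quaternionic modulus, |q| = sqrt (q * conj q).\<close>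

lemma quat_mult_qcnj: "q * qcnj q = of_real ((norm q)\<^sup>2)"
  by (simp add: quat_eq_iff norm_quat_def power2_eq_square algebra_simps)

instance quat :: real_normed_div_algebra
proof
  fix p q :: quat
  have "(QRe (p * q))\<^sup>2 + (QI (p * q))\<^sup>2 + (QJ (p * q))\<^sup>2 + (QK (p * q))\<^sup>2 =
    ((QRe p)\<^sup>2 + (QI p)\<^sup>2 + (QJ p)\<^sup>2 + (QK p)\<^sup>2) *
    ((QRe q)\<^sup>2 + (QI q)\<^sup>2 + (QJ q)\<^sup>2 + (QK q)\<^sup>2)"
    by (simp add: power2_eq_square algebra_simps)
  then show "norm (p * q) = norm p * norm q"
    by (simp only: norm_quat_def real_sqrt_mult)
qed

instantiation quat :: euclidean_space
begin

definition "Basis = {Quat 1 0 0 0, Quat 0 1 0 0, Quat 0 0 1 0, Quat 0 0 0 1}"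

instance
proof
  show "(Basis :: quat set) \<noteq> {}" "finite (Basis :: quat set)"
    by (simp_all add: Basis_quat_def)
  show "inner u v = (if u = v then 1 else 0)" if "u \<in> Basis" "v \<in> Basis" for u v :: quat
    using that unfolding Basis_quat_def
    by (elim insertE emptyE; simp add: inner_quat_def)
  show "(\<forall>u\<in>Basis. inner x u = 0) \<longleftrightarrow> x = 0" for x :: quat
    by (cases x) (simp add: Basis_quat_def inner_quat_def zero_quat_def)
qed

end


section \<open>Slices and slice regular functions\<close>

definition imag_units :: "quat set"
  where "imag_units = {q. q\<^sup>2 = - 1}"

text \<open>
  The point x + I y of the slice \<open>C_I\<close>. For an imaginary unit I this identifies \<open>real \<times> real\<close> with
  \<open>C_I\<close>; restrictions to \<open>C_I\<close>, and the measure dx dy on it, are expressed in these coordinates.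
\<close>

definition slice_point :: "quat \<Rightarrow> real \<times> real \<Rightarrow> quat"
  where "slice_point I z = of_real (fst z) + I * of_real (snd z)"

definition slice_regular :: "(quat \<Rightarrow> quat) \<Rightarrow> bool"
  where "slice_regular f \<longleftrightarrow>
    (\<forall>q. f differentiable (at q)) \<and>
    (\<forall>I\<in>imag_units. \<exists>fx fy :: real \<times> real \<Rightarrow> quat.
      continuous_on UNIV fx \<and> continuous_on UNIV fy \<and>
      (\<forall>x y.
        ((\<lambda>s. f (slice_point I (s, y))) has_vector_derivative fx (x, y)) (at x) \<and>
        ((\<lambda>t. f (slice_point I (x, t))) has_vector_derivative fy (x, y)) (at y) \<and>
        (1 / 2) * (fx (x, y) + I * fy (x, y)) = 0))"


section \<open>The space of square integrable functions and the Fock space\<close>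

text \<open>
  Square integrable functions are represented by functions rather than by classes modulo
  null sets.
\<close>

definition L2_quat :: "(real \<Rightarrow> quat) set"
  where "L2_quat =
    {\<psi>. \<psi> \<in> borel_measurable lebesgue \<and> integrable lebesgue (\<lambda>t. (norm (\<psi> t))\<^sup>2)}"

definition L2_inner :: "(real \<Rightarrow> quat) \<Rightarrow> (real \<Rightarrow> quat) \<Rightarrow> quat"
  where "L2_inner \<psi> \<phi> = (LINT t|lebesgue. qcnj (\<phi> t) * \<psi> t)"

definition fock_space :: "real \<Rightarrow> quat \<Rightarrow> (quat \<Rightarrow> quat) set"
  where "fock_space \<nu> I = {f. slice_regular f \<and>
    integrable lebesgue
      (\<lambda>z. (norm (f (slice_point I z)))\<^sup>2 * exp (- \<nu> * (norm (slice_point I z))\<^sup>2))}"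

definition fock_inner :: "real \<Rightarrow> quat \<Rightarrow> (quat \<Rightarrow> quat) \<Rightarrow> (quat \<Rightarrow> quat) \<Rightarrow> quat"
  where "fock_inner \<nu> I f g =
    (LINT z|lebesgue. qcnj (g (slice_point I z)) * f (slice_point I z) *
      of_real (exp (- \<nu> * (norm (slice_point I z))\<^sup>2)))"


section \<open>The quaternionic Segal-Bargmann transform\<close>

definition SB_kernel :: "real \<Rightarrow> quat \<Rightarrow> real \<Rightarrow> quat"
  where "SB_kernel \<nu> q x = of_real ((\<nu> / pi) powr (3 / 4)) *
    exp (- of_real (\<nu> / 2) * (q\<^sup>2 + of_real (x\<^sup>2)) + of_real (\<nu> * sqrt 2) * q * of_real x)"

definition SB_transform :: "real \<Rightarrow> (real \<Rightarrow> quat) \<Rightarrow> quat \<Rightarrow> quat"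
  where "SB_transform \<nu> \<phi> q = (LINT x|lebesgue. SB_kernel \<nu> q x * \<phi> x)"

end

theory Submission
  imports Defs "HOL-Probability.Characteristic_Functions"
begin

text \<open>
  On the slice of \<open>I\<close>, at the point u + I v, the transform of f is up to a unimodular factor and a real
  Gaussian factor the Fourier transform, taken with \<open>I\<close> as imaginary unit and at frequency
  \<open>\<nu> sqrt 2 v\<close>, of the product of f with a Gaussian depending on u. Plancherel's theorem in v
  followed by a Gaussian integral in u turns the Fock norm of the transform into the \<open>L2\<close> norm of f;
  right linearity and polarization then give the inner products.

  Plancherel's theorem for integrable, square integrable h is obtained by weighting
  \<open>|h^(v)|^2\<close> with \<open>exp (- (s v)^2 / 2)\<close>: Fubini turns the weighted integral into the average of the
  autocorrelation of h against a normal density of width s, and s tends to 0. Continuity of the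
  autocorrelation at 0 comes from approximation by continuous functions.

  The transform is slice regular because it is \<open>exp (- \<nu> q^2 / 2)\<close> times an everywhere convergent
  power series in q with right coefficients.
\<close>

section \<open>Imaginary units and the kernel on a slice\<close>

text \<open>Quaternions do not commute, so in the Fourier integral the values of h cannot be moved
  past \<open>I\<close>; they are not split into \<open>C_I\<close>-valued parts either. Only the
  real inner product is used. Left multiplication by an imaginary unit is orthogonal and skew for
  it, so \<open>|h^(v)|^2\<close> becomes a double integral of a cosine and a sine of v (x - y), and
  the sine drops out against the even weight. The weight is there because \<open>|h^|^2\<close> is
  not known to be integrable beforehand: with it Fubini applies, and its removal is a monotone
  limit.

  The real inner product also shapes the last step: it sees only the real part of the quaternionic
  one, and the other components are recovered by pairing f with every right multiple g e.

  The constant (\<nu> / pi)^(3/4) is the one whose square cancels 2 pi / (\<nu> sqrt 2), from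
  Plancherel at the rescaled frequency, and sqrt (pi / (2 \<nu>)), from the Gaussian in u.\<close>

lemma bounded_linear_qcnj: "bounded_linear qcnj"
  by (rule bounded_linear_intro[where K=1]) (auto simp: norm_quat_def quat_eq_iff)

text \<open>The imaginary components of \<open>I * I\<close> are \<open>2 * QRe I\<close> times
  those of \<open>I\<close>. If \<open>QRe I\<close> were nonzero, those of \<open>I\<close> would
  vanish and -1 would be a real square.\<close>

lemma imag_unitsD:
  assumes "I \<in> imag_units"
  shows "QRe I = 0" "(QI I)\<^sup>2 + (QJ I)\<^sup>2 + (QK I)\<^sup>2 = 1" "I * I = - 1"
proof -
  show sq: "I * I = -1" using assms by (simp add: imag_units_def power2_eq_square)
  then have e: "QRe I * QRe I - QI I * QI I - QJ I * QJ I - QK I * QK I = -1"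
    "2 * (QRe I * QI I) = 0" "2 * (QRe I * QJ I) = 0" "2 * (QRe I * QK I) = 0"
    by (simp_all add: quat_eq_iff) auto
  show re: "QRe I = 0"
  proof (rule ccontr)
    assume "QRe I \<noteq> 0"
    with e have "QRe I * QRe I = -1" by simp
    then show False using zero_le_square[of "QRe I"] by linarith
  qed
  show "(QI I)\<^sup>2 + (QJ I)\<^sup>2 + (QK I)\<^sup>2 = 1" using e(1) re by (simp add: power2_eq_square)
qed

lemma norm_slice_point:
  assumes "I \<in> imag_units"
  shows "(norm (slice_point I z))\<^sup>2 = (fst z)\<^sup>2 + (snd z)\<^sup>2"
proof -
  have "(norm (slice_point I z))\<^sup>2 = (fst z)\<^sup>2 + ((QI I)\<^sup>2 + (QJ I)\<^sup>2 + (QK I)\<^sup>2) * (snd z)\<^sup>2"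
    using imag_unitsD(1)[OF assms]
    by (simp add: slice_point_def norm_quat_def power_mult_distrib algebra_simps)
  then show ?thesis using imag_unitsD(2)[OF assms] by simp
qed

text \<open>The analogue of \<open>cis\<close> with \<open>I\<close> as imaginary unit, that is exp
  (t I) by \<open>exp_scaleR_imag_unit\<close>. With cos and sin in the definition, norm and
  continuity are immediate.\<close>

definition qcis :: "quat \<Rightarrow> real \<Rightarrow> quat"
  where "qcis I t = slice_point I (cos t, sin t)"

lemma norm_qcis [simp]: "I \<in> imag_units \<Longrightarrow> norm (qcis I t) = 1"
  using norm_slice_point[of I "(cos t, sin t)"] norm_ge_zero[of "qcis I t"]
  by (simp add: qcis_def power2_eq_1_iff del: norm_ge_zero)

lemma continuous_on_qcis [continuous_intros]:
  fixes f :: "'a::t2_space \<Rightarrow> real"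
  shows "continuous_on S f \<Longrightarrow> continuous_on S (\<lambda>x. qcis I (f x))"
  unfolding qcis_def slice_point_def by (simp, intro continuous_intros)

lemma qcis_add: "I \<in> imag_units \<Longrightarrow> qcis I (s + t) = qcis I s * qcis I t"
  using imag_unitsD(3)[of I] 
  by (simp add: qcis_def slice_point_def cos_add sin_add algebra_simps of_real_def)

text \<open>Left multiplication by \<open>I\<close> is orthogonal (1) and skew (2), whatever a and b
  are. Expanding both factors as in (3), the four products collapse by the subtraction formulas for
  cos and sin.\<close>

lemma inner_qcis_mult:
  assumes "I \<in> imag_units"
  shows "inner (qcis I s * a) (qcis I t * b) =
    cos (s - t) * inner a b + sin (s - t) * inner (I * a) b"
proof -
  have 1: "inner (I * a) (I * b) = inner a b"
  proof -
    have "inner (I * a) (I * b) = ((QI I)\<^sup>2 + (QJ I)\<^sup>2 + (QK I)\<^sup>2) * inner a b"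
      using imag_unitsD(1)[OF assms] by (simp add: inner_quat_def power2_eq_square algebra_simps)
    then show ?thesis using imag_unitsD(2)[OF assms] by simp
  qed
  have 2: "inner a (I * b) = - inner (I * a) b"
    using imag_unitsD(1)[OF assms] by (simp add: inner_quat_def algebra_simps)
  have 3: "qcis I t * b = cos t *\<^sub>R b + sin t *\<^sub>R (I * b)" for t b
    by (simp add: qcis_def slice_point_def of_real_def algebra_simps)
  show ?thesis
    by (simp add: 3 inner_add_left inner_add_right 1 2 cos_diff sin_diff algebra_simps)
qed

text \<open>The product \<open>g\<close> of the exponential with the inverse of
  \<open>qcis I t\<close> has derivative zero and equals 1 at t = 0.\<close>

lemma exp_scaleR_imag_unit:
  assumes "I \<in> imag_units"
  shows "exp (t *\<^sub>R I) = qcis I t"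
proof -
  define g where "g t = qcis I (- t) * exp (t *\<^sub>R I)" for t
  have g: "qcis I (- t) = cos t *\<^sub>R 1 - sin t *\<^sub>R I" for t
    by (simp add: qcis_def slice_point_def of_real_def)
  have I2: "I * (I * x) = - x" for x
    using imag_unitsD(3)[OF assms] by (metis mult.assoc mult_minus1)
  have "(g has_vector_derivative 0) (at t)" for t
  proof -
    have "((\<lambda>t. cos t *\<^sub>R 1 - sin t *\<^sub>R I) has_vector_derivative
      - sin t *\<^sub>R 1 - cos t *\<^sub>R I) (at t)"
      by (auto intro!: derivative_eq_intros
          simp: has_vector_derivative_def fun_eq_iff algebra_simps)
    from has_vector_derivative_mult[OF this exp_scaleR_has_vector_derivative_left[of I t]]
    show ?thesis unfolding g_def g by (simp add: algebra_simps I2)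
  qed
  then have "(g has_derivative (\<lambda>h. 0)) (at t)" for t
    by (simp add: has_vector_derivative_def)
  with has_derivative_zero_constant[of UNIV g] obtain c where "\<And>t. g t = c"
    by auto
  then have "g t = g 0" by simp
  then have gt: "qcis I (- t) * exp (t *\<^sub>R I) = 1"
    by (simp add: g_def qcis_def slice_point_def)
  have "qcis I t * qcis I (-t) = 1"
    using qcis_add[OF assms, of t "- t"] by (simp add: qcis_def slice_point_def)
  then have "exp (t *\<^sub>R I) = qcis I t * (qcis I (-t) * exp (t *\<^sub>R I))"
    by (simp flip: mult.assoc)
  then show ?thesis using gt by simp
qed

lemma exp_slice_point:
  assumes "I \<in> imag_units"
  shows "exp (slice_point I (u, v)) = exp u *\<^sub>R qcis I v"
proof -
  have "slice_point I (u, v) = of_real u + v *\<^sub>R I"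
    by (simp add: slice_point_def of_real_def)
  moreover have "exp (of_real u + v *\<^sub>R I) = exp (of_real u) * exp (v *\<^sub>R I)"
    by (rule exp_add_commuting) (simp add: of_real_def)
  ultimately show ?thesis
    by (simp add: exp_scaleR_imag_unit[OF assms] exp_of_real) (simp add: of_real_def)
qed

lemma of_real_slice_point: "of_real r = slice_point I (r, 0)"
  by (simp add: slice_point_def)

lemma slice_point_algebra:
  assumes "I \<in> imag_units"
  shows "slice_point I (a, b) + slice_point I (c, d) = slice_point I (a + c, b + d)"
    "slice_point I (a, b) * slice_point I (c, d) = slice_point I (a * c - b * d, a * d + b * c)"
    "- slice_point I (a, b) = slice_point I (- a, - b)"
  using imag_unitsD(3)[OF assms]
  by (simp_all add: slice_point_def algebra_simps of_real_def)

text \<open>The exponent stays in the slice and is computed there like a complex number: its real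
  part gives the Gaussian, its imaginary part the phase.\<close>

lemma SB_kernel_slice_point:
  assumes "I \<in> imag_units"
  shows "SB_kernel \<nu> (slice_point I (u, v)) x =
    ((\<nu> / pi) powr (3 / 4) * exp (- (\<nu> / 2) * (u\<^sup>2 - v\<^sup>2 + x\<^sup>2) + \<nu> * sqrt 2 * u * x)) *\<^sub>R
      qcis I (\<nu> * sqrt 2 * v * x - \<nu> * u * v)"
proof -
  have "- of_real (\<nu> / 2) * ((slice_point I (u, v))\<^sup>2 + of_real (x\<^sup>2)) +
      of_real (\<nu> * sqrt 2) * slice_point I (u, v) * of_real x = 
    slice_point I (- (\<nu> / 2) * (u\<^sup>2 - v\<^sup>2 + x\<^sup>2) + \<nu> * sqrt 2 * u * x,
      \<nu> * sqrt 2 * v * x - \<nu> * u * v)"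
    unfolding power2_eq_square[of "slice_point I (u,v)"]
    by (simp only: of_real_slice_point[of _ I] slice_point_algebra[OF assms]) (simp add: power2_eq_square algebra_simps)
  then show ?thesis
    unfolding SB_kernel_def by (simp only: exp_slice_point[OF assms]) (simp add: of_real_def)
qed

section \<open>Square integrable functions and autocorrelation\<close>

lemma norm_add_square_le:
  fixes a b :: "'a::real_inner"
  shows "(norm (a + b))\<^sup>2 \<le> 2 * (norm a)\<^sup>2 + 2 * (norm b)\<^sup>2"
  using zero_le_power2[of "norm (a - b)"]
  by (simp add: power2_norm_eq_inner inner_add inner_diff inner_commute del: zero_le_power2)

lemma abs_inner_le:
  fixes a b :: "'a::real_inner"
  shows "\<bar>inner a b\<bar> \<le> ((norm a)\<^sup>2 + (norm b)\<^sup>2) / 2"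
proof -
  have "\<bar>inner a b\<bar> \<le> norm a * norm b" by (rule Cauchy_Schwarz_ineq2)
  also have "\<dots> \<le> ((norm a)\<^sup>2 + (norm b)\<^sup>2) / 2"
    using sum_squares_bound[of "norm a" "norm b"] by simp
  finally show ?thesis .
qed

text \<open>Borel functions and \<open>lborel\<close>, unlike in \<open>L2_quat\<close>, because
  Fubini is used throughout and a product of completed measures need not be complete. The domain is
  general so as to cover both the line and the plane of a slice.\<close>

definition square_integrable :: "('a::euclidean_space \<Rightarrow> 'b::euclidean_space) \<Rightarrow> bool"
  where "square_integrable h \<longleftrightarrow>
    h \<in> borel_measurable borel \<and> integrable lborel (\<lambda>x. (norm (h x))\<^sup>2)"

lemma square_integrableD:
  assumes "square_integrable h"
  shows "h \<in> borel_measurable borel" "integrable lborel (\<lambda>x. (norm (h x))\<^sup>2)"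
  using assms by (auto simp: square_integrable_def)

lemma square_integrable_add:
  assumes "square_integrable f" "square_integrable g"
  shows "square_integrable (\<lambda>x. f x + g x)"
  unfolding square_integrable_def
proof
  note [measurable] = assms[THEN square_integrableD(1)]
  show "(\<lambda>x. f x + g x) \<in> borel_measurable borel" by measurable
  show "integrable lborel (\<lambda>x. (norm (f x + g x))\<^sup>2)"
  proof (rule Bochner_Integration.integrable_bound)
    show "integrable lborel (\<lambda>x. 2 * (norm (f x))\<^sup>2 + 2 * (norm (g x))\<^sup>2)"
      using assms[THEN square_integrableD(2)] by auto
  qed (use norm_add_square_le[of "f _" "g _"] in auto)
qed

lemma square_integrable_scaleR:
  assumes "square_integrable f"
  shows "square_integrable (\<lambda>x. c *\<^sub>R f x)"
  using assms by (auto simp: square_integrable_def power_mult_distrib)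

lemma square_integrable_diff:
  assumes "square_integrable f" "square_integrable g"
  shows "square_integrable (\<lambda>x. f x - g x)"
  using square_integrable_add[OF assms(1) square_integrable_scaleR[OF assms(2), of "-1"]] by simp

lemma square_integrable_inner:
  assumes "square_integrable f" "square_integrable g"
  shows "integrable lborel (\<lambda>x. inner (f x) (g x))"
proof (rule Bochner_Integration.integrable_bound)
  note [measurable] = assms[THEN square_integrableD(1)]
  show "(\<lambda>x. inner (f x) (g x)) \<in> borel_measurable lborel" by measurable
  show "integrable lborel (\<lambda>x. ((norm (f x))\<^sup>2 + (norm (g x))\<^sup>2) / 2)"
    using assms[THEN square_integrableD(2)] by auto
  show "AE x in lborel. norm (inner (f x) (g x)) \<le> norm (((norm (f x))\<^sup>2 + (norm (g x))\<^sup>2) / 2)"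
    using abs_inner_le[of "f _" "g _"] by simp
qed

section \<open>Approximation by continuous functions of bounded support\<close>

lemma L2_approx_truncate:
  fixes h :: "'a::euclidean_space \<Rightarrow> 'b::euclidean_space"
  assumes "square_integrable h"
  shows "(\<lambda>n. \<integral>x. (norm (h x - (if norm (h x) \<le> real n \<and> norm x \<le> real n then h x else 0)))\<^sup>2 \<partial>lborel)
    \<longlonglongrightarrow> 0"
proof -
  note [measurable] = square_integrableD(1)[OF assms]
  let ?k = "\<lambda>n x. if norm (h x) \<le> real n \<and> norm x \<le> real n then h x else 0"
  have "(\<lambda>n. \<integral>x. (norm (h x - ?k n x))\<^sup>2 \<partial>lborel) \<longlonglongrightarrow> (\<integral>(x::'a). 0 \<partial>lborel)"
  proof (rule integral_dominated_convergence)
    show "integrable lborel (\<lambda>x. (norm (h x))\<^sup>2)" using square_integrableD(2)[OF assms] .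
    show "AE x in lborel. (\<lambda>n. (norm (h x - ?k n x))\<^sup>2) \<longlonglongrightarrow> 0"
    proof (rule AE_I2, rule tendsto_eventually)
      fix x
      have "\<forall>\<^sub>F n in sequentially. max (norm (h x)) (norm x) \<le> real n"
        by (rule filterlim_real_sequentially[unfolded filterlim_at_top, rule_format])
      then show "\<forall>\<^sub>F n in sequentially. (norm (h x - ?k n x))\<^sup>2 = 0"
        by eventually_elim auto
    qed
  qed (auto intro!: AE_I2)
  then show ?thesis by simp
qed

text \<open>Measurability yields continuous functions \<open>g n\<close> converging to h almost
  everywhere, but without any bound. Projecting their values onto the ball of radius M, which is
  continuous and fixes the values of h, and cutting off at infinity give a dominated sequence with
  the same limit.\<close>

lemma L2_approx_continuous_bounded:
  fixes h :: "'a::euclidean_space \<Rightarrow> 'b::euclidean_space"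
  assumes [measurable]: "h \<in> borel_measurable borel"
    and bnd: "\<And>x. norm (h x) \<le> M" and supp: "\<And>x. norm x > M \<Longrightarrow> h x = 0" and e: "0 < e"
  shows "\<exists>k. continuous_on UNIV k \<and> (\<forall>x. norm (k x) \<le> M) \<and> (\<forall>x. norm x > M + 1 \<longrightarrow> k x = 0) \<and>
    (\<integral>x. (norm (h x - k x))\<^sup>2 \<partial>lborel) < e"
proof -
  have M: "0 \<le> M" using bnd[of 0] norm_ge_zero order_trans by blast
  have "h \<in> borel_measurable lebesgue" by (simp add: measurable_completion)
  then have "h measurable_on UNIV" by (simp add: lebesgue_measurable_imp_measurable_on)
  then obtain N g where N: "negligible N" and g: "\<And>n. continuous_on UNIV (g n)"
    "\<And>x. x \<notin> N \<Longrightarrow> (\<lambda>n. g n x) \<longlonglongrightarrow> h x"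
    by (auto simp: measurable_on_def)
  have AE_N: "AE x in lborel. x \<notin> N"
    using N by (metis AE_completion_iff AE_not_in negligible_iff_null_sets)
  have cball: "convex (cball (0::'b) M)" "closed (cball (0::'b) M)" "cball (0::'b) M \<noteq> {}"
    using M by auto
  \<comment> \<open>The cutoff is 1 on the ball of radius M, outside of which h vanishes, and 0
    beyond radius M + 1.\<close>
  define c where "c x = max 0 (min 1 (M + 1 - norm x))" for x :: 'a
  define k where "k n x = c x *\<^sub>R closest_point (cball 0 M) (g n x)" for n x
  have c01: "0 \<le> c x" "c x \<le> 1" for x by (auto simp: c_def)
  have kc: "continuous_on UNIV (k n)" for n
    unfolding k_def c_def
    by (intro continuous_intros continuous_on_compose2[OF continuous_on_closest_point[OF cball] g(1)]) auto
  have kM: "norm (k n x) \<le> M" for n x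
  proof -
    have "norm (closest_point (cball 0 M) (g n x)) \<le> M"
      using closest_point_in_set[OF cball(2,3)] by simp
    then have "c x * norm (closest_point (cball 0 M) (g n x)) \<le> 1 * M"
      using c01[of x] by (intro mult_mono) auto
    then show ?thesis using c01[of x] by (simp add: k_def)
  qed
  have k0: "k n x = 0" if "norm x > M + 1" for n x using that by (simp add: k_def c_def)
  have [measurable]: "k n \<in> borel_measurable borel" for n
    by (rule borel_measurable_continuous_onI[OF kc])
  have "(\<lambda>n. \<integral>x. (norm (h x - k n x))\<^sup>2 \<partial>lborel) \<longlonglongrightarrow> (\<integral>(x::'a). 0 \<partial>lborel)"
  proof (rule integral_dominated_convergence)
    show "integrable lborel (\<lambda>x::'a. (2 * M)\<^sup>2 * indicat_real (cball 0 (M + 1)) x)"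
      by (intro integrable_mult_right integrable_real_indicator) (use emeasure_lborel_cball_finite[of "0::'a" "M + 1"] in auto)
    show "AE x in lborel. norm ((norm (h x - k n x))\<^sup>2) \<le> (2 * M)\<^sup>2 * indicat_real (cball 0 (M + 1)) x" for n
    proof (rule AE_I2)
      fix x
      have "norm (h x - k n x) \<le> 2 * M" 
        using norm_triangle_ineq4[of "h x" "k n x"] bnd[of x] kM[of n x] by simp
      then show "norm ((norm (h x - k n x))\<^sup>2) \<le> (2 * M)\<^sup>2 * indicat_real (cball 0 (M + 1)) x"
        using supp[of x] k0[of x n] power_mono[of "norm (h x - k n x)" "2 * M" 2]
        by (auto simp: indicator_def)
    qed
    show "AE x in lborel. (\<lambda>n. (norm (h x - k n x))\<^sup>2) \<longlonglongrightarrow> 0"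
      using AE_N
    proof eventually_elim
      fix x assume x: "x \<notin> N"
      have "(\<lambda>n. closest_point (cball 0 M) (g n x)) \<longlonglongrightarrow> closest_point (cball 0 M) (h x)"
        by (rule isCont_tendsto_compose[OF _ g(2)[OF x]]) (rule continuous_at_closest_point[OF cball])
      then have "(\<lambda>n. k n x) \<longlonglongrightarrow> c x *\<^sub>R h x"
        unfolding k_def using closest_point_self[of "h x" "cball 0 M"] bnd[of x] by (auto intro!: tendsto_intros)
      moreover have "c x *\<^sub>R h x = h x"
        using supp[of x] by (cases "norm x > M") (auto simp: c_def)
      ultimately have "(\<lambda>n. k n x) \<longlonglongrightarrow> h x" by simp
      then have "(\<lambda>n. (norm (h x - k n x))\<^sup>2) \<longlonglongrightarrow> (norm (h x - h x))\<^sup>2"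
        by (intro tendsto_intros)
      then show "(\<lambda>n. (norm (h x - k n x))\<^sup>2) \<longlonglongrightarrow> 0" by simp
    qed
  qed auto
  then have "\<forall>\<^sub>F n in sequentially. (\<integral>x. (norm (h x - k n x))\<^sup>2 \<partial>lborel) < e"
    using e by (auto dest!: order_tendstoD(2)[where a=e])
  then obtain n where "(\<integral>x. (norm (h x - k n x))\<^sup>2 \<partial>lborel) < e"
    by (auto simp: eventually_sequentially)
  then show ?thesis using kc kM k0 by blast
qed

lemma integrable_bounded_support:
  fixes k :: "'a::euclidean_space \<Rightarrow> 'b::euclidean_space"
  assumes [measurable]: "k \<in> borel_measurable borel"
    and bnd: "\<And>x. norm (k x) \<le> M" and supp: "\<And>x. norm x > R \<Longrightarrow> k x = 0"
  shows "integrable lborel k"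
proof (rule Bochner_Integration.integrable_bound)
  show "integrable lborel (\<lambda>x::'a. M * indicat_real (cball 0 R) x)"
    by (intro integrable_mult_right integrable_real_indicator) (use emeasure_lborel_cball_finite[of "0::'a" R] in auto)
  show "AE x in lborel. norm (k x) \<le> norm (M * indicat_real (cball 0 R) x)"
  proof (rule AE_I2)
    fix x show "norm (k x) \<le> norm (M * indicat_real (cball 0 R) x)"
      using bnd[of x] supp[of x] by (auto simp: indicator_def)
  qed
qed auto

lemma L2_approx_continuous:
  fixes h :: "'a::euclidean_space \<Rightarrow> 'b::euclidean_space"
  assumes h: "square_integrable h" and e: "0 < e"
  obtains k M R where "continuous_on UNIV k" "\<And>x. norm (k x) \<le> M" "\<And>x. norm x > R \<Longrightarrow> k x = 0"
    "square_integrable k" "(\<integral>x. (norm (h x - k x))\<^sup>2 \<partial>lborel) < e"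
proof -
  note [measurable] = square_integrableD(1)[OF h]
  define t where "t n x = (if norm (h x) \<le> real n \<and> norm x \<le> real n then h x else 0)" for n x
  have [measurable]: "t n \<in> borel_measurable borel" for n unfolding t_def by measurable
  \<comment> \<open>Truncation and smoothing each get e / 4, since \<open>norm_add_square_le\<close>
    doubles both errors.\<close>
  have "\<forall>\<^sub>F n in sequentially. (\<integral>x. (norm (h x - t n x))\<^sup>2 \<partial>lborel) < e / 4"
    using order_tendstoD(2)[OF L2_approx_truncate[OF h], of "e / 4"] e by (simp add: t_def)
  then obtain n where n: "(\<integral>x. (norm (h x - t n x))\<^sup>2 \<partial>lborel) < e / 4"
    by (auto simp: eventually_sequentially)
  have "\<exists>k. continuous_on UNIV k \<and> (\<forall>x. norm (k x) \<le> real n) \<and> (\<forall>x. norm x > real n + 1 \<longrightarrow> k x = 0) \<and>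
    (\<integral>x. (norm (t n x - k x))\<^sup>2 \<partial>lborel) < e / 4"
    by (rule L2_approx_continuous_bounded) (use e in \<open>auto simp: t_def\<close>)
  then obtain k where k: "continuous_on UNIV k" "\<And>x. norm (k x) \<le> real n"
    "\<And>x. norm x > real n + 1 \<Longrightarrow> k x = 0" "(\<integral>x. (norm (t n x - k x))\<^sup>2 \<partial>lborel) < e / 4"
    by blast
  have [measurable]: "k \<in> borel_measurable borel"
    by (rule borel_measurable_continuous_onI[OF k(1)])
  have "integrable lborel (\<lambda>x. (norm (k x))\<^sup>2)"
    by (rule integrable_bounded_support[where M="(real n)\<^sup>2" and R="real n + 1"])
       (auto simp: k(3) intro!: power_mono k(2))
  then have sk: "square_integrable k" by (simp add: square_integrable_def)
  have "integrable lborel (\<lambda>x. (norm (t n x))\<^sup>2)"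
    by (rule integrable_bounded_support[where M="(real n)\<^sup>2" and R="real n"])
       (auto simp: t_def intro!: power_mono)
  then have st: "square_integrable (t n)" by (simp add: square_integrable_def)
  note i1 = square_integrableD(2)[OF square_integrable_diff[OF h st]]
  note i2 = square_integrableD(2)[OF square_integrable_diff[OF st sk]]
  have "(\<integral>x. (norm (h x - k x))\<^sup>2 \<partial>lborel) \<le>
    (\<integral>x. 2 * (norm (h x - t n x))\<^sup>2 + 2 * (norm (t n x - k x))\<^sup>2 \<partial>lborel)"
    using i1 i2 square_integrableD(2)[OF square_integrable_diff[OF h sk]]
  proof (intro integral_mono)
    fix x show "(norm (h x - k x))\<^sup>2 \<le> 2 * (norm (h x - t n x))\<^sup>2 + 2 * (norm (t n x - k x))\<^sup>2"
      using norm_add_square_le[of "h x - t n x" "t n x - k x"] by simp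
  qed auto
  also have "\<dots> < e" using i1 i2 n k(4) by simp
  finally have "(\<integral>x. (norm (h x - k x))\<^sup>2 \<partial>lborel) < e" .
  with k sk show thesis by (intro that) auto
qed

section \<open>Autocorrelation and translations\<close>

definition autocorr :: "(real \<Rightarrow> 'b::euclidean_space) \<Rightarrow> real \<Rightarrow> real"
  where "autocorr h t = (\<integral>y. inner (h (y + t)) (h y) \<partial>lborel)"

lemma square_integrable_shift:
  fixes h :: "real \<Rightarrow> 'b::euclidean_space"
  assumes "square_integrable h"
  shows "square_integrable (\<lambda>y. h (y + t))"
  using assms lborel_integrable_real_affine[of "\<lambda>x. (norm (h x))\<^sup>2" 1 t]
  by (auto simp: square_integrable_def add.commute)

lemma integral_shift:
  fixes f :: "real \<Rightarrow> real"
  shows "(\<integral>y. f (y + t) \<partial>lborel) = (\<integral>y. f y \<partial>lborel)"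
  using lborel_integral_real_affine[of 1 f t] by (simp add: add.commute)

lemma autocorr_0: "autocorr h 0 = (\<integral>y. (norm (h y))\<^sup>2 \<partial>lborel)"
  by (simp add: autocorr_def power2_norm_eq_inner)

text \<open>Expand the square; by translation invariance both squared norms integrate to
  \<open>autocorr h 0\<close>. Continuity of the autocorrelation at 0 thus amounts to continuity of
  translation in L2.\<close>

lemma autocorr_diff:
  fixes h :: "real \<Rightarrow> 'b::euclidean_space"
  assumes h: "square_integrable h"
  shows "(\<integral>y. (norm (h (y + t) - h y))\<^sup>2 \<partial>lborel) = 2 * (autocorr h 0 - autocorr h t)"
proof -
  note i = square_integrableD(2)[OF h] square_integrableD(2)[OF square_integrable_shift[OF h, of t]]
    square_integrable_inner[OF square_integrable_shift[OF h, of t] h]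
  have "(norm (h (y + t) - h y))\<^sup>2 = (norm (h (y + t)))\<^sup>2 + (norm (h y))\<^sup>2 - 2 * inner (h (y + t)) (h y)" for y
    by (simp add: power2_norm_eq_inner inner_diff_left inner_diff_right inner_commute)
  then have "(\<integral>y. (norm (h (y + t) - h y))\<^sup>2 \<partial>lborel) =
    (\<integral>y. (norm (h (y + t)))\<^sup>2 \<partial>lborel) + (\<integral>y. (norm (h y))\<^sup>2 \<partial>lborel) - 2 * autocorr h t"
    using i by (simp add: autocorr_def)
  then show ?thesis
    by (simp add: integral_shift[of "\<lambda>y. (norm (h y))\<^sup>2"] autocorr_0)
qed

text \<open>Uniform in t and with the absolute value inside, as needed for the majorant in Fubini's
  theorem.\<close>

lemma integral_abs_inner_shift_le:
  fixes h :: "real \<Rightarrow> 'b::euclidean_space"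
  assumes h: "square_integrable h"
  shows "(\<integral>y. \<bar>inner (h (y + t)) (h y)\<bar> \<partial>lborel) \<le> autocorr h 0"
proof -
  note i = square_integrableD(2)[OF h] square_integrableD(2)[OF square_integrable_shift[OF h, of t]]
    square_integrable_inner[OF square_integrable_shift[OF h, of t] h]
  have "(\<integral>y. \<bar>inner (h (y + t)) (h y)\<bar> \<partial>lborel) \<le>
      (\<integral>y. ((norm (h (y + t)))\<^sup>2 + (norm (h y))\<^sup>2) / 2 \<partial>lborel)"
    using i by (intro integral_mono abs_inner_le) auto
  also have "\<dots> = autocorr h 0"
    using i by (simp add: integral_shift[of "\<lambda>y. (norm (h y))\<^sup>2"] autocorr_0)
  finally show ?thesis .
qed

lemma abs_autocorr_le:
  fixes h :: "real \<Rightarrow> 'b::euclidean_space"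
  assumes "square_integrable h"
  shows "\<bar>autocorr h t\<bar> \<le> autocorr h 0"
  unfolding autocorr_def[of h t]
  using integral_abs_bound integral_abs_inner_shift_le[OF assms] by (rule order_trans)

text \<open>For a bounded, continuous and integrable k this is dominated convergence. For h,
  \<open>autocorr_diff\<close> reduces it to the distance between h and its translate, which is
  compared with that of a nearby k.\<close>

lemma autocorr_tendsto_0:
  fixes h :: "real \<Rightarrow> 'b::euclidean_space"
  assumes h: "square_integrable h" and X: "X \<longlonglongrightarrow> 0"
  shows "(\<lambda>n. autocorr h (X n)) \<longlonglongrightarrow> autocorr h 0"
proof (rule LIMSEQ_I)
  fix e :: real assume e: "0 < e"
  obtain k M R where k: "continuous_on UNIV k" "\<And>x. norm (k x) \<le> M" "\<And>x. norm x > R \<Longrightarrow> k x = 0"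
    "square_integrable k" "(\<integral>x. (norm (h x - k x))\<^sup>2 \<partial>lborel) < e / 8"
    using L2_approx_continuous[OF h, of "e / 8"] e by auto
  note [measurable] = square_integrableD(1)[OF k(4)] square_integrableD(1)[OF h]
  have kint: "integrable lborel k"
    by (rule integrable_bounded_support[OF _ k(2,3)]) auto
  have "(\<lambda>n. autocorr k (X n)) \<longlonglongrightarrow> autocorr k 0"
    unfolding autocorr_def
  proof (rule integral_dominated_convergence)
    show "integrable lborel (\<lambda>y. M * norm (k y))" using kint by auto
    show "AE y in lborel. (\<lambda>n. inner (k (y + X n)) (k y)) \<longlonglongrightarrow> inner (k (y + 0)) (k y)"
    proof (rule AE_I2)
      fix y
      have "isCont k (y + 0)" using k(1) by (simp add: continuous_on_eq_continuous_at)
      moreover have "(\<lambda>n. y + X n) \<longlonglongrightarrow> y + 0" using X by (intro tendsto_intros)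
      ultimately have "(\<lambda>n. k (y + X n)) \<longlonglongrightarrow> k (y + 0)" by (rule isCont_tendsto_compose)
      then show "(\<lambda>n. inner (k (y + X n)) (k y)) \<longlonglongrightarrow> inner (k (y + 0)) (k y)"
        by (intro tendsto_intros)
    qed
    show "AE y in lborel. norm (inner (k (y + X n)) (k y)) \<le> M * norm (k y)" for n
    proof (rule AE_I2)
      fix y
      have "\<bar>inner (k (y + X n)) (k y)\<bar> \<le> norm (k (y + X n)) * norm (k y)" by (rule Cauchy_Schwarz_ineq2)
      also have "\<dots> \<le> M * norm (k y)" by (intro mult_right_mono k(2)) auto
      finally show "norm (inner (k (y + X n)) (k y)) \<le> M * norm (k y)" by simp
    qed
  qed auto
  then obtain N where N: "\<And>n. n \<ge> N \<Longrightarrow> norm (autocorr k (X n) - autocorr k 0) < e / 8"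
    using LIMSEQ_D[of _ "autocorr k 0" "e / 8"] e by auto
  have "norm (autocorr h (X n) - autocorr h 0) < e" if n: "n \<ge> N" for n
  proof -
    define t where "t = X n"
    have hk: "square_integrable (\<lambda>x. h x - k x)" by (rule square_integrable_diff[OF h k(4)])
    note i = square_integrableD(2)[OF square_integrable_diff[OF square_integrable_shift[OF h] h]]
      square_integrableD(2)[OF square_integrable_diff[OF square_integrable_shift[OF k(4)] k(4)]]
      square_integrableD(2)[OF square_integrable_shift[OF hk]] square_integrableD(2)[OF hk]
    have "2 * (autocorr h 0 - autocorr h t) = (\<integral>y. (norm (h (y + t) - h y))\<^sup>2 \<partial>lborel)"
      using autocorr_diff[OF h] by simp
    also have "\<dots> \<le> (\<integral>y. 4 * (norm (h (y + t) - k (y + t)))\<^sup>2 + 4 * (norm (h y - k y))\<^sup>2 +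
        2 * (norm (k (y + t) - k y))\<^sup>2 \<partial>lborel)"
    proof (intro integral_mono)
      fix y
      have "(norm (h (y + t) - h y))\<^sup>2 \<le>
        2 * (norm ((h (y + t) - k (y + t)) - (h y - k y)))\<^sup>2 + 2 * (norm (k (y + t) - k y))\<^sup>2"
        using norm_add_square_le[of "(h (y + t) - k (y + t)) - (h y - k y)" "k (y + t) - k y"]
        by (simp add: algebra_simps)
      moreover have "(norm ((h (y + t) - k (y + t)) - (h y - k y)))\<^sup>2 \<le>
        2 * (norm (h (y + t) - k (y + t)))\<^sup>2 + 2 * (norm (h y - k y))\<^sup>2"
        using norm_add_square_le[of "h (y + t) - k (y + t)" "- (h y - k y)"]
        by (simp only: add_uminus_conv_diff norm_minus_cancel)
      ultimately show "(norm (h (y + t) - h y))\<^sup>2 \<le> 4 * (norm (h (y + t) - k (y + t)))\<^sup>2 +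
        4 * (norm (h y - k y))\<^sup>2 + 2 * (norm (k (y + t) - k y))\<^sup>2" by simp
    qed (use i in auto)
    also have "\<dots> = 8 * (\<integral>y. (norm (h y - k y))\<^sup>2 \<partial>lborel) + 4 * (autocorr k 0 - autocorr k t)"
      using i by (simp add: integral_shift[of "\<lambda>y. (norm (h y - k y))\<^sup>2"] autocorr_diff[OF k(4)])
    \<comment> \<open>The bound is below 8 (e / 8) + 4 (e / 8) = 3 e / 2.\<close>
    also have "\<dots> < 2 * e"
      using k(5) N[OF n] by (simp add: t_def) argo
    \<comment> \<open>A one-sided estimate is enough because the autocorrelation is largest at
      0.\<close>
    finally show ?thesis using abs_autocorr_le[OF h, of t] by (simp add: t_def)
  qed
  then show "\<exists>N. \<forall>n\<ge>N. norm (autocorr h (X n) - autocorr h 0) < e" by blast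
qed

section \<open>Plancherel's theorem\<close>

lemma measurable_qcis [measurable]:
  "f \<in> borel_measurable M \<Longrightarrow> (\<lambda>x. qcis I (f x)) \<in> borel_measurable M"
  by (rule borel_measurable_continuous_on[where f="qcis I"]) (auto intro!: continuous_intros)

section \<open>Cosine and sine integrals of the Gaussian\<close>

lemma integral_std_normal_cos:
  "integrable lborel (\<lambda>x. std_normal_density x * cos (t * x))"
  "(\<integral>x. std_normal_density x * cos (t * x) \<partial>lborel) = exp (- t\<^sup>2 / 2)"
proof -
  have i: "integrable lborel (\<lambda>x. std_normal_density x *\<^sub>R iexp (t * x))"
    by (rule Bochner_Integration.integrable_bound[OF integrable_normal_density[of 1 0]]) auto
  have "(CLINT x|lborel. std_normal_density x *\<^sub>R iexp (t * x)) = complex_of_real (exp (- (t\<^sup>2) / 2))"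
    using fun_cong[OF char_std_normal_distribution, of t]
    by (simp add: char_def integral_density)
  \<comment> \<open>The cosine integral is the real part of the characteristic function of the
    standard normal distribution.\<close>
  then have "Re (CLINT x|lborel. std_normal_density x *\<^sub>R iexp (t * x)) = exp (- t\<^sup>2 / 2)"
    by simp
  then show "(\<integral>x. std_normal_density x * cos (t * x) \<partial>lborel) = exp (- t\<^sup>2 / 2)"
    using i by (simp flip: integral_Re add: Re_exp)
  show "integrable lborel (\<lambda>x. std_normal_density x * cos (t * x))"
    using integrable_Re[OF i] by (simp add: Re_exp)
qed

lemma integral_std_normal_sin:
  "integrable lborel (\<lambda>x. std_normal_density x * sin (t * x))"
  "(\<integral>x. std_normal_density x * sin (t * x) \<partial>lborel) = 0"
proof -
  show "integrable lborel (\<lambda>x. std_normal_density x * sin (t * x))"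
    by (rule Bochner_Integration.integrable_bound[OF integrable_normal_density[of 1 0]])
       (auto simp: abs_mult intro!: mult_left_le)
  \<comment> \<open>The reflection of x to -x turns the odd integrand into its negative.\<close>
  show "(\<integral>x. std_normal_density x * sin (t * x) \<partial>lborel) = 0"
    using lborel_integral_real_affine[of "-1" "\<lambda>x. std_normal_density x * sin (t * x)" 0]
    by (simp add: std_normal_density_def)
qed

text \<open>Substitute x = s v in the standard normal integrals, at frequency t / s. The value is
  written as a multiple of a density of width s in order to exhibit the approximate identity that
  arises as s tends to 0.\<close>

lemma gaussian_cos_sin:
  assumes s: "s > 0"
  shows "has_bochner_integral lborel (\<lambda>v. exp (- (s * v)\<^sup>2 / 2) * cos (v * t)) (2 * pi * normal_density 0 s t)"
    "has_bochner_integral lborel (\<lambda>v. exp (- (s * v)\<^sup>2 / 2) * sin (v * t)) 0"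
proof -
  have e: "exp (- (s * v)\<^sup>2 / 2) = sqrt (2 * pi) * std_normal_density (0 + s * v)" for v
    by (simp add: std_normal_density_def)
  have a: "v * t = (t / s) * (0 + s * v)" for v using s by simp
  have "has_bochner_integral lborel (\<lambda>x. sqrt (2 * pi) * (std_normal_density x * cos ((t / s) * x)))
    (sqrt (2 * pi) * exp (- (t / s)\<^sup>2 / 2))"
    by (intro has_bochner_integral_mult_right) (use integral_std_normal_cos[of "t / s"] in \<open>simp add: has_bochner_integral_iff\<close>)
  from this[THEN lborel_has_bochner_integral_real_affine_iff[THEN iffD1, rotated], of s 0] s
  have "has_bochner_integral lborel (\<lambda>v. exp (- (s * v)\<^sup>2 / 2) * cos (v * t)) (sqrt (2 * pi) * exp (- (t / s)\<^sup>2 / 2) /\<^sub>R \<bar>s\<bar>)"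
    unfolding e a by (simp add: mult.assoc)
  moreover have "sqrt (2 * pi) * exp (- (t / s)\<^sup>2 / 2) /\<^sub>R \<bar>s\<bar> = 2 * pi * normal_density 0 s t"
  proof -
    have "2 * pi / sqrt (2 * pi) = sqrt (2 * pi)" by (simp add: real_div_sqrt)
    then show ?thesis using s
      by (simp add: normal_density_def real_sqrt_mult power_divide field_simps)
  qed
  ultimately show "has_bochner_integral lborel (\<lambda>v. exp (- (s * v)\<^sup>2 / 2) * cos (v * t)) (2 * pi * normal_density 0 s t)"
    by simp
  have "has_bochner_integral lborel (\<lambda>x. sqrt (2 * pi) * (std_normal_density x * sin ((t / s) * x)))
    (sqrt (2 * pi) * 0)"
    by (intro has_bochner_integral_mult_right) (use integral_std_normal_sin[of "t / s"] in \<open>simp add: has_bochner_integral_iff\<close>)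
  from this[THEN lborel_has_bochner_integral_real_affine_iff[THEN iffD1, rotated], of s 0] s
  show "has_bochner_integral lborel (\<lambda>v. exp (- (s * v)\<^sup>2 / 2) * sin (v * t)) 0"
    unfolding e a by (simp add: mult.assoc)
qed

lemma integrable_gaussian: "s > 0 \<Longrightarrow> integrable lborel (\<lambda>v::real. exp (- (s * v)\<^sup>2 / 2))"
  using gaussian_cos_sin(1)[of s 0] by (simp add: has_bochner_integral_iff)

text \<open>By Cauchy-Schwarz the product of the norms is a majorant. The general pair of measures
  serves two uses: the plane, and the line against the plane with real functions, for which
  \<open>inner\<close> is multiplication.\<close>

lemma (in pair_sigma_finite) integrable_inner_product:
  fixes f :: "'a \<Rightarrow> 'c::euclidean_space" and g :: "'b \<Rightarrow> 'c"
  assumes f: "integrable M1 f" and g: "integrable M2 g"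
  shows "integrable (M1 \<Otimes>\<^sub>M M2) (\<lambda>(x, y). inner (f x) (g y))"
proof (rule Fubini_integrable)
  note [measurable] = borel_measurable_integrable[OF f] borel_measurable_integrable[OF g]
  show "(\<lambda>(x, y). inner (f x) (g y)) \<in> borel_measurable (M1 \<Otimes>\<^sub>M M2)" by measurable
  have "integrable M1 (\<lambda>x. \<integral>y. \<bar>inner (f x) (g y)\<bar> \<partial>M2)"
  proof (rule Bochner_Integration.integrable_bound)
    show "integrable M1 (\<lambda>x. norm (f x) * (\<integral>y. norm (g y) \<partial>M2))" using f by simp
    show "AE x in M1. norm (\<integral>y. \<bar>inner (f x) (g y)\<bar> \<partial>M2) \<le> norm (norm (f x) * (\<integral>y. norm (g y) \<partial>M2))"
    proof (rule AE_I2)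
      fix x
      have "(\<integral>y. \<bar>inner (f x) (g y)\<bar> \<partial>M2) \<le> (\<integral>y. norm (f x) * norm (g y) \<partial>M2)"
        using f g by (intro integral_mono integrable_abs Cauchy_Schwarz_ineq2) auto
      then show "norm (\<integral>y. \<bar>inner (f x) (g y)\<bar> \<partial>M2) \<le> norm (norm (f x) * (\<integral>y. norm (g y) \<partial>M2))"
        by simp
    qed
  qed measurable
  then show "integrable M1 (\<lambda>x. \<integral>y. norm (case (x, y) of (x, y) \<Rightarrow> inner (f x) (g y)) \<partial>M2)" by simp
  show "AE x in M1. integrable M2 (\<lambda>y. case (x, y) of (x, y) \<Rightarrow> inner (f x) (g y))"
    using g by simp
qed

lemma (in pair_sigma_finite) integral_inner_product:
  fixes f :: "'a \<Rightarrow> 'c::euclidean_space" and g :: "'b \<Rightarrow> 'c"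
  assumes f: "integrable M1 f" and g: "integrable M2 g"
  shows "(\<integral>p. inner (f (fst p)) (g (snd p)) \<partial>(M1 \<Otimes>\<^sub>M M2)) = inner (\<integral>x. f x \<partial>M1) (\<integral>y. g y \<partial>M2)"
proof -
  have "(\<integral>p. inner (f (fst p)) (g (snd p)) \<partial>(M1 \<Otimes>\<^sub>M M2)) = (\<integral>x. (\<integral>y. inner (f x) (g y) \<partial>M2) \<partial>M1)"
    using integral_fst'[OF integrable_inner_product[OF f g]] by (simp add: case_prod_beta')
  also have "\<dots> = inner (\<integral>x. f x \<partial>M1) (\<integral>y. g y \<partial>M2)"
    using f g by simp
  finally show ?thesis .
qed

text \<open>The exponential stands to the left of \<open>h\<close>, as the kernel of the transform
  does. There is no normalizing factor, hence the 2 pi in \<open>plancherel_quat\<close>.\<close>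

definition fourier :: "quat \<Rightarrow> (real \<Rightarrow> quat) \<Rightarrow> real \<Rightarrow> quat"
  where "fourier I h v = (\<integral>x. qcis I (v * x) * h x \<partial>lborel)"

lemma integrable_qcis_mult:
  assumes "I \<in> imag_units" and h: "integrable lborel h" and [measurable]: "c \<in> borel_measurable borel"
  shows "integrable lborel (\<lambda>x. qcis I (c x) * h x)"
proof (rule Bochner_Integration.integrable_bound[OF h])
  note [measurable] = borel_measurable_integrable[OF h]
  show "(\<lambda>x. qcis I (c x) * h x) \<in> borel_measurable lborel" by measurable
qed (simp add: norm_mult assms(1))

lemma fourier_measurable [measurable]:
  assumes [measurable]: "h \<in> borel_measurable borel"
  shows "fourier I h \<in> borel_measurable borel"
  unfolding fourier_def[abs_def] by measurable

lemma norm_fourier_le: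
  assumes "I \<in> imag_units"
  shows "norm (fourier I h v) \<le> (\<integral>x. norm (h x) \<partial>lborel)"
  using integral_norm_bound[of lborel "\<lambda>x. qcis I (v * x) * h x"]
  by (simp add: fourier_def norm_mult assms)

lemma fourier_weighted:
  assumes I: "I \<in> imag_units" and h: "integrable lborel h" and h2: "square_integrable h" and s: "s > 0"
  shows "integrable lborel (\<lambda>v. exp (- (s * v)\<^sup>2 / 2) * (norm (fourier I h v))\<^sup>2)" (is ?int)
    "(\<integral>v. exp (- (s * v)\<^sup>2 / 2) * (norm (fourier I h v))\<^sup>2 \<partial>lborel) =
      2 * pi * (\<integral>r. std_normal_density r * autocorr h (s * r) \<partial>lborel)" (is ?eq)
proof -
  note [measurable] = square_integrableD(1)[OF h2]
  let ?w = "\<lambda>v. exp (- (s * v)\<^sup>2 / 2)"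
  let ?P = "lborel \<Otimes>\<^sub>M lborel :: (real \<times> real) measure"
  \<comment> \<open>The frequency v is paired with the plane of points (x, y), because the squared
    norm of the transform is an integral over that plane.\<close>
  interpret P: pair_sigma_finite "lborel :: real measure" ?P
    by (intro pair_sigma_finite.intro lborel.sigma_finite_measure_axioms) (simp add: lborel_prod lborel.sigma_finite_measure_axioms)
  show ?int
  proof (rule Bochner_Integration.integrable_bound)
    show "integrable lborel (\<lambda>v. ?w v * (\<integral>x. norm (h x) \<partial>lborel)\<^sup>2)"
      using integrable_gaussian[OF s] by simp
    show "AE v in lborel. norm (?w v * (norm (fourier I h v))\<^sup>2) \<le> norm (?w v * (\<integral>x. norm (h x) \<partial>lborel)\<^sup>2)"
      using norm_fourier_le[OF I, of h] by (auto intro!: mult_left_mono power_mono)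
  qed measurable
  define A where "A v p = inner (qcis I (v * fst p) * h (fst p)) (qcis I (v * snd p) * h (snd p))" for v p
  have [measurable]: "(\<lambda>(v, p). A v p) \<in> borel_measurable (lborel \<Otimes>\<^sub>M ?P)"
    unfolding A_def by measurable
  have A: "(norm (fourier I h v))\<^sup>2 = (\<integral>p. A v p \<partial>?P)" for v
    unfolding fourier_def A_def power2_norm_eq_inner
    by (rule lborel_pair.integral_inner_product[symmetric]; intro integrable_qcis_mult I h; measurable)
  \<comment> \<open>The majorant for Fubini: its integrability in v comes from the weight, that in x
    and y from h being in L1.\<close>
  have "integrable (lborel \<Otimes>\<^sub>M ?P) (\<lambda>(v, p). inner (?w v) (norm (h (fst p)) * norm (h (snd p))))"
    by (intro P.integrable_inner_product integrable_gaussian s)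
       (use lborel_pair.integrable_inner_product[of "\<lambda>x. norm (h x)" "\<lambda>x. norm (h x)"] h in
         \<open>simp add: case_prod_beta'\<close>)
  then have iwA: "integrable (lborel \<Otimes>\<^sub>M ?P) (\<lambda>(v, p). ?w v * A v p)"
  proof (rule Bochner_Integration.integrable_bound)
    have "\<bar>A v p\<bar> \<le> norm (h (fst p)) * norm (h (snd p))" for v p
      unfolding A_def using Cauchy_Schwarz_ineq2[of "qcis I (v * fst p) * h (fst p)" "qcis I (v * snd p) * h (snd p)"]
      by (simp add: norm_mult I)
    then show "AE x in lborel \<Otimes>\<^sub>M ?P. norm (case x of (v, p) \<Rightarrow> ?w v * A v p) \<le>
       norm (case x of (v, p) \<Rightarrow> inner (?w v) (norm (h (fst p)) * norm (h (snd p))))"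
      by (auto simp: abs_mult intro!: AE_I2 mult_left_mono)
  qed measurable
  \<comment> \<open>The sine part integrates to 0 although \<open>I * h\<close> need not be
    orthogonal to \<open>h\<close>; the cosine part leaves the density.\<close>
  have Av: "(\<integral>v. ?w v * A v p \<partial>lborel) = 2 * pi * normal_density 0 s (fst p - snd p) * inner (h (fst p)) (h (snd p))" for p
  proof -
    have "has_bochner_integral lborel (\<lambda>v. ?w v * cos (v * (fst p - snd p)) * inner (h (fst p)) (h (snd p)) +
      ?w v * sin (v * (fst p - snd p)) * inner (I * h (fst p)) (h (snd p)))
      (2 * pi * normal_density 0 s (fst p - snd p) * inner (h (fst p)) (h (snd p)) + 0 * inner (I * h (fst p)) (h (snd p)))"
      by (intro has_bochner_integral_add has_bochner_integral_mult_left gaussian_cos_sin s)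
    moreover have "?w v * A v p = ?w v * cos (v * (fst p - snd p)) * inner (h (fst p)) (h (snd p)) +
      ?w v * sin (v * (fst p - snd p)) * inner (I * h (fst p)) (h (snd p))" for v
      unfolding A_def inner_qcis_mult[OF I] by (simp add: algebra_simps)
    ultimately show ?thesis by (simp add: has_bochner_integral_iff)
  qed
  have "(\<integral>v. ?w v * (norm (fourier I h v))\<^sup>2 \<partial>lborel) = (\<integral>v. (\<integral>p. ?w v * A v p \<partial>?P) \<partial>lborel)"
    by (simp add: A)
  also have "\<dots> = (\<integral>p. (\<integral>v. ?w v * A v p \<partial>lborel) \<partial>?P)"
    by (rule P.Fubini_integral[OF iwA, symmetric])
  also have "\<dots> = (\<integral>p. (case p of (x, y) \<Rightarrow> 2 * pi * normal_density 0 s (x - y) * inner (h x) (h y)) \<partial>?P)"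
    by (simp only: Av case_prod_beta')
  also have "\<dots> = (\<integral>y. (\<integral>x. 2 * pi * normal_density 0 s (x - y) * inner (h x) (h y) \<partial>lborel) \<partial>lborel)"
  proof (rule lborel_pair.integral_snd[symmetric])
    show "integrable ?P (\<lambda>(x, y). 2 * pi * normal_density 0 s (x - y) * inner (h x) (h y))"
      using P.integrable_snd[OF iwA] by (simp only: Av case_prod_beta')
  qed
  \<comment> \<open>Substituting x = y + s r makes the density independent of s. Only the argument
    of the autocorrelation still contains s, which suits dominated convergence later.\<close>
  also have "\<dots> = (\<integral>y. (\<integral>r. 2 * pi * (std_normal_density r * inner (h (y + s * r)) (h y)) \<partial>lborel) \<partial>lborel)"
  proof (rule Bochner_Integration.integral_cong[OF refl])
    fix y
    have n: "s * normal_density 0 s (s * r) = std_normal_density r" for r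
      using s by (simp add: normal_density_def real_sqrt_mult power_mult_distrib)
    have "(\<integral>x. 2 * pi * normal_density 0 s (x - y) * inner (h x) (h y) \<partial>lborel) =
      \<bar>s\<bar> *\<^sub>R (\<integral>r. 2 * pi * normal_density 0 s (y + s * r - y) * inner (h (y + s * r)) (h y) \<partial>lborel)"
      using s by (intro lborel_integral_real_affine) simp
    also have "\<dots> = (\<integral>r. s * (2 * pi * normal_density 0 s (s * r) * inner (h (y + s * r)) (h y)) \<partial>lborel)"
      using s by simp
    also have "\<dots> = (\<integral>r. 2 * pi * (std_normal_density r * inner (h (y + s * r)) (h y)) \<partial>lborel)"
      by (simp only: n[symmetric] ac_simps)
    finally show "(\<integral>x. 2 * pi * normal_density 0 s (x - y) * inner (h x) (h y) \<partial>lborel) =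
      (\<integral>r. 2 * pi * (std_normal_density r * inner (h (y + s * r)) (h y)) \<partial>lborel)" .
  qed
  also have "\<dots> = (\<integral>r. (\<integral>y. 2 * pi * (std_normal_density r * inner (h (y + s * r)) (h y)) \<partial>lborel) \<partial>lborel)"
  proof (rule lborel_pair.Fubini_integral)
    show "integrable ?P (\<lambda>(r, y). 2 * pi * (std_normal_density r * inner (h (y + s * r)) (h y)))"
    proof (rule lborel_pair.Fubini_integrable)
      have i: "integrable lborel (\<lambda>y. inner (h (y + s * r)) (h y))" for r
        by (rule square_integrable_inner[OF square_integrable_shift[OF h2] h2])
      then show "AE r in lborel. integrable lborel (\<lambda>y. case (r, y) of (r, y) \<Rightarrow>
        2 * pi * (std_normal_density r * inner (h (y + s * r)) (h y)))" by simp
      have "(\<integral>y. \<bar>inner (h (y + s * r)) (h y)\<bar> \<partial>lborel) \<le> autocorr h 0" for r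
        by (rule integral_abs_inner_shift_le[OF h2])
      moreover have "integrable lborel (\<lambda>r. 2 * pi * (std_normal_density r * autocorr h 0))" by simp
      ultimately have "integrable lborel (\<lambda>r. 2 * pi * (std_normal_density r * (\<integral>y. \<bar>inner (h (y + s * r)) (h y)\<bar> \<partial>lborel)))"
        by (elim Bochner_Integration.integrable_bound)
           (auto simp: abs_mult intro!: AE_I2 mult_left_mono order_trans[OF _ abs_ge_self])
      then show "integrable lborel (\<lambda>r. \<integral>y. norm (case (r, y) of (r, y) \<Rightarrow>
        2 * pi * (std_normal_density r * inner (h (y + s * r)) (h y))) \<partial>lborel)"
        by (simp add: abs_mult)
    qed measurable
  qed
  also have "\<dots> = 2 * pi * (\<integral>r. std_normal_density r * autocorr h (s * r) \<partial>lborel)"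
    by (simp add: autocorr_def)
  finally show ?eq .
qed

text \<open>The weighted integrals have two limits as the width shrinks: dominated convergence
  evaluates the averages of the autocorrelation, and monotone convergence removes the weight. With
  nonnegative integrals, square integrability of the transform is part of the conclusion.\<close>

lemma plancherel_quat:
  assumes I: "I \<in> imag_units" and h: "integrable lborel h" and h2: "square_integrable h"
  shows "(\<integral>\<^sup>+v. ennreal ((norm (fourier I h v))\<^sup>2) \<partial>lborel) = ennreal (2 * pi * (\<integral>x. (norm (h x))\<^sup>2 \<partial>lborel))"
proof -
  note [measurable] = square_integrableD(1)[OF h2]
  define s where "s n = 1 / real (Suc n)" for n
  have s: "s n > 0" for n by (simp add: s_def)
  have s0: "s \<longlonglongrightarrow> 0" unfolding s_def by (rule LIMSEQ_Suc[OF lim_const_over_n])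
  define w where "w n v = exp (- (s n * v)\<^sup>2 / 2) * (norm (fourier I h v))\<^sup>2" for n v
  have "(\<lambda>n. \<integral>r. std_normal_density r * autocorr h (s n * r) \<partial>lborel) \<longlonglongrightarrow>
    (\<integral>r. std_normal_density r * autocorr h 0 \<partial>lborel)"
  proof (rule integral_dominated_convergence)
    show "integrable lborel (\<lambda>r. std_normal_density r * autocorr h 0)" by simp
    show "AE r in lborel. (\<lambda>n. std_normal_density r * autocorr h (s n * r)) \<longlonglongrightarrow> std_normal_density r * autocorr h 0"
      by (intro AE_I2 tendsto_mult_left autocorr_tendsto_0[OF h2] tendsto_mult_left_zero s0)
    show "AE r in lborel. norm (std_normal_density r * autocorr h (s n * r)) \<le> std_normal_density r * autocorr h 0" for n
      by (intro AE_I2) (auto simp: abs_mult intro!: mult_left_mono abs_autocorr_le[OF h2])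
    show "(\<lambda>r. std_normal_density r * autocorr h (s n * r)) \<in> borel_measurable lborel" for n
      unfolding autocorr_def by measurable
  qed auto
  then have "(\<lambda>n. 2 * pi * (\<integral>r. std_normal_density r * autocorr h (s n * r) \<partial>lborel)) \<longlonglongrightarrow>
    2 * pi * autocorr h 0"
    by (intro tendsto_mult_left) simp
  then have "(\<lambda>n. integral\<^sup>L lborel (w n)) \<longlonglongrightarrow> 2 * pi * autocorr h 0"
    unfolding w_def fourier_weighted(2)[OF I h h2 s] .
  then have "(\<lambda>n. ennreal (integral\<^sup>L lborel (w n))) \<longlonglongrightarrow> ennreal (2 * pi * autocorr h 0)"
    by (rule tendsto_ennrealI)
  moreover have "ennreal (integral\<^sup>L lborel (w n)) = (\<integral>\<^sup>+v. ennreal (w n v) \<partial>lborel)" for n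
    unfolding w_def by (rule nn_integral_eq_integral[symmetric, OF fourier_weighted(1)[OF I h h2 s]]) simp
  ultimately have 1: "(\<lambda>n. \<integral>\<^sup>+v. ennreal (w n v) \<partial>lborel) \<longlonglongrightarrow> ennreal (2 * pi * autocorr h 0)"
    by simp
  have 2: "(\<lambda>n. \<integral>\<^sup>+v. ennreal (w n v) \<partial>lborel) \<longlonglongrightarrow> (\<integral>\<^sup>+v. ennreal ((norm (fourier I h v))\<^sup>2) \<partial>lborel)"
  proof (rule nn_integral_LIMSEQ)
    show "incseq (\<lambda>n v. ennreal (w n v))"
    proof (intro incseq_SucI le_funI ennreal_leI)
      fix n v
      have "s (Suc n) \<le> s n" by (simp add: s_def field_simps)
      then have "(s (Suc n) * v)\<^sup>2 \<le> (s n * v)\<^sup>2"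
        using s[of "Suc n"] by (simp add: power_mult_distrib mult_right_mono power_mono)
      then show "w n v \<le> w (Suc n) v" by (simp add: w_def mult_right_mono)
    qed
    show "(\<lambda>n. ennreal (w n v)) \<longlonglongrightarrow> ennreal ((norm (fourier I h v))\<^sup>2)" for v
    proof (rule tendsto_ennrealI)
      have "(\<lambda>n. w n v) \<longlonglongrightarrow> exp (- (0 * v)\<^sup>2 / 2) * (norm (fourier I h v))\<^sup>2"
        unfolding w_def by (intro tendsto_intros s0) auto
      then show "(\<lambda>n. w n v) \<longlonglongrightarrow> (norm (fourier I h v))\<^sup>2" by simp
    qed
    show "(\<lambda>v. ennreal (w n v)) \<in> borel_measurable lborel" for n unfolding w_def by measurable
  qed
  show ?thesis using LIMSEQ_unique[OF 2 1] by (simp add: autocorr_0)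
qed

section \<open>The isometry on a slice\<close>

lemma integral_exp_minus_square:
  assumes "a > 0"
  shows "has_bochner_integral lborel (\<lambda>x. exp (- a * (x - m)\<^sup>2)) (sqrt (pi / a))"
proof -
  \<comment> \<open>The standard deviation for which the normal density has exponent
    \<open>- a * (x - m)\<^sup>2\<close>.\<close>
  define s where "s = 1 / sqrt (2 * a)"
  have s: "s > 0" "2 * s\<^sup>2 = 1 / a" using assms by (simp_all add: s_def power_divide)
  have "has_bochner_integral lborel (\<lambda>x. sqrt (pi / a) * normal_density m s x) (sqrt (pi / a) * 1)"
    by (intro has_bochner_integral_mult_right) (use s in \<open>simp add: has_bochner_integral_iff\<close>)
  moreover have "sqrt (pi / a) * normal_density m s x = exp (- a * (x - m)\<^sup>2)" for x
  proof -
    have "2 * pi * s\<^sup>2 = pi / a" using s(2) by (simp add: field_simps)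
    then show ?thesis using assms s(2) by (simp add: normal_density_def)
  qed
  ultimately show ?thesis by simp
qed

section \<open>Gaussian multiples of square integrable functions\<close>

lemma exp_quadratic_square_integrable:
  fixes a b :: real
  assumes a: "a > 0"
  shows "square_integrable (\<lambda>x::real. exp (- (a / 2) * x\<^sup>2 + b * x))"
proof -
  have "(norm (exp (- (a / 2) * x\<^sup>2 + b * x)))\<^sup>2 = exp (b\<^sup>2 / a) * exp (- a * (x - b / a)\<^sup>2)" for x
    using a by (simp add: power2_eq_square field_simps flip: exp_add)
  then show ?thesis
    using integral_exp_minus_square[OF a, of "b / a"] by (simp add: square_integrable_def has_bochner_integral_iff)
qed

text \<open>The exponent is largest at x = b / a.\<close>

lemma exp_quadratic_le:
  fixes a b :: real
  assumes a: "a > 0"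
  shows "exp (- (a / 2) * x\<^sup>2 + b * x) \<le> exp (b\<^sup>2 / (2 * a))"
proof -
  have "b\<^sup>2 / (2 * a) - (- (a / 2) * x\<^sup>2 + b * x) = (a / 2) * (x - b / a)\<^sup>2"
    using a by (simp add: power2_eq_square field_simps)
  moreover have "0 \<le> (a / 2) * (x - b / a)\<^sup>2" using a by simp
  ultimately show ?thesis by simp
qed

lemma integrable_scaleR_square_integrable:
  fixes f :: "'a::euclidean_space \<Rightarrow> 'b::euclidean_space"
  assumes "square_integrable g" "square_integrable f"
  shows "integrable lborel (\<lambda>x. g x *\<^sub>R f x)"
proof (rule Bochner_Integration.integrable_bound)
  note [measurable] = assms[THEN square_integrableD(1)]
  show "(\<lambda>x. g x *\<^sub>R f x) \<in> borel_measurable lborel" by measurable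
  show "integrable lborel (\<lambda>x. ((norm (g x))\<^sup>2 + (norm (f x))\<^sup>2) / 2)"
    using assms[THEN square_integrableD(2)] by auto
  show "AE x in lborel. norm (g x *\<^sub>R f x) \<le> norm (((norm (g x))\<^sup>2 + (norm (f x))\<^sup>2) / 2)"
    using abs_inner_le[of "\<bar>g _\<bar>" "norm (f _)"] by (auto simp: abs_mult)
qed

text \<open>With a = \<nu> and b = \<nu> sqrt 2 u this is the factor depending on x in the modulus
  of the kernel at u + I v. For a > 0 it sends L2 into the intersection of L1 and L2, where
  \<open>plancherel_quat\<close> applies.\<close>

definition gauss_mult :: "real \<Rightarrow> real \<Rightarrow> (real \<Rightarrow> 'b::euclidean_space) \<Rightarrow> real \<Rightarrow> 'b"
  where "gauss_mult a b f x = exp (- (a / 2) * x\<^sup>2 + b * x) *\<^sub>R f x"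

lemma gauss_mult_integrable:
  "a > 0 \<Longrightarrow> square_integrable f \<Longrightarrow> integrable lborel (gauss_mult a b f)"
  unfolding gauss_mult_def[abs_def]
  by (intro integrable_scaleR_square_integrable exp_quadratic_square_integrable)

lemma gauss_mult_square_integrable:
  assumes a: "a > 0" and f: "square_integrable f"
  shows "square_integrable (gauss_mult a b f)"
proof -
  note [measurable] = square_integrableD(1)[OF f]
  have "integrable lborel (\<lambda>x. (norm (gauss_mult a b f x))\<^sup>2)"
  proof (rule Bochner_Integration.integrable_bound)
    show "integrable lborel (\<lambda>x. (exp (b\<^sup>2 / (2 * a)))\<^sup>2 * (norm (f x))\<^sup>2)"
      using square_integrableD(2)[OF f] by simp
    show "AE x in lborel. norm ((norm (gauss_mult a b f x))\<^sup>2) \<le> norm ((exp (b\<^sup>2 / (2 * a)))\<^sup>2 * (norm (f x))\<^sup>2)"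
      using exp_quadratic_le[OF a, of _ b]
      by (auto simp: gauss_mult_def power_mult_distrib intro!: AE_I2 mult_right_mono power_mono)
  qed (unfold gauss_mult_def, measurable)
  then show ?thesis unfolding square_integrable_def gauss_mult_def[abs_def] by simp
qed

text \<open>Carries measurability and integrability, once known on slices, to an arbitrary
  quaternion. The unit is the normalized imaginary part; a real q lies in every slice, and i is
  taken.\<close>

lemma quat_in_slice: "\<exists>J\<in>imag_units. \<exists>z. q = slice_point J z"
proof (cases "QI q = 0 \<and> QJ q = 0 \<and> QK q = 0")
  case True
  then have "q = slice_point (Quat 0 1 0 0) (QRe q, 0)"
    by (simp add: slice_point_def quat_eq_iff)
  moreover have "Quat 0 1 0 0 \<in> imag_units"
    by (simp add: imag_units_def power2_eq_square quat_eq_iff)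
  ultimately show ?thesis by blast
next
  case False
  define m where "m = sqrt ((QI q)\<^sup>2 + (QJ q)\<^sup>2 + (QK q)\<^sup>2)"
  have "(QI q)\<^sup>2 + (QJ q)\<^sup>2 + (QK q)\<^sup>2 \<noteq> 0"
    using False by (auto simp: add_nonneg_eq_0_iff)
  then have m: "m \<noteq> 0" "m * m = QI q * QI q + QJ q * QJ q + QK q * QK q"
    by (auto simp: m_def simp flip: power2_eq_square)
  define J where "J = Quat 0 (QI q / m) (QJ q / m) (QK q / m)"
  have "J \<in> imag_units"
    using m(1) by (simp add: imag_units_def J_def power2_eq_square quat_eq_iff m(2)[symmetric]
        divide_simps) (simp add: m(2))
  moreover have "q = slice_point J (QRe q, m)"
    using m by (simp add: slice_point_def J_def quat_eq_iff)
  ultimately show ?thesis by blast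
qed

section \<open>The transform on a slice\<close>

definition SB_lborel :: "real \<Rightarrow> (real \<Rightarrow> quat) \<Rightarrow> quat \<Rightarrow> quat"
  where "SB_lborel \<nu> f q = (\<integral>x. SB_kernel \<nu> q x * f x \<partial>lborel)"

lemma SB_kernel_measurable [measurable]: "SB_kernel \<nu> q \<in> borel_measurable borel"
proof -
  obtain J z where "J \<in> imag_units" "q = slice_point J z" using quat_in_slice by blast
  then have "SB_kernel \<nu> q = SB_kernel \<nu> (slice_point J (fst z, snd z))" by simp
  then show ?thesis
    unfolding SB_kernel_slice_point[OF \<open>J \<in> imag_units\<close>, abs_def] by simp
qed

text \<open>The factors free of x are collected on the left, so that integration over x leaves
  exactly a \<open>fourier\<close> integral.\<close>

lemma SB_kernel_mult_slice_point:
  assumes I: "I \<in> imag_units"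
  shows "SB_kernel \<nu> (slice_point I (u, v)) x * f x =
    ((\<nu> / pi) powr (3 / 4) * exp (- (\<nu> / 2) * (u\<^sup>2 - v\<^sup>2))) *\<^sub>R
      (qcis I (- \<nu> * u * v) * (qcis I ((\<nu> * sqrt 2 * v) * x) * gauss_mult \<nu> (\<nu> * sqrt 2 * u) f x))"
proof -
  have "exp (- (\<nu> / 2) * (u\<^sup>2 - v\<^sup>2 + x\<^sup>2) + \<nu> * sqrt 2 * u * x) =
    exp (- (\<nu> / 2) * (u\<^sup>2 - v\<^sup>2)) * exp (- (\<nu> / 2) * x\<^sup>2 + \<nu> * sqrt 2 * u * x)"
    by (simp add: algebra_simps flip: exp_add)
  moreover have "qcis I (\<nu> * sqrt 2 * v * x - \<nu> * u * v) = qcis I (- \<nu> * u * v) * qcis I ((\<nu> * sqrt 2 * v) * x)"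
    by (subst qcis_add[OF I, symmetric]) simp
  ultimately show ?thesis
    by (simp add: SB_kernel_slice_point[OF I] gauss_mult_def mult.assoc)
qed

lemma SB_kernel_integrable:
  assumes "\<nu> > 0" "square_integrable f"
  shows "integrable lborel (\<lambda>x. SB_kernel \<nu> q x * f x)"
proof -
  obtain J z where J: "J \<in> imag_units" "q = slice_point J z" using quat_in_slice by blast
  have "integrable lborel (\<lambda>x. qcis J ((\<nu> * sqrt 2 * snd z) * x) * gauss_mult \<nu> (\<nu> * sqrt 2 * fst z) f x)"
    by (intro integrable_qcis_mult J gauss_mult_integrable assms) simp
  then have "integrable lborel (\<lambda>x. SB_kernel \<nu> (slice_point J (fst z, snd z)) x * f x)"
    unfolding SB_kernel_mult_slice_point[OF J(1)] by (intro integrable_scaleR_right integrable_mult_right)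
  then show ?thesis using J by simp
qed

lemma SB_lborel_slice_point:
  assumes "\<nu> > 0" and I: "I \<in> imag_units" and f: "square_integrable f"
  shows "SB_lborel \<nu> f (slice_point I (u, v)) =
    ((\<nu> / pi) powr (3 / 4) * exp (- (\<nu> / 2) * (u\<^sup>2 - v\<^sup>2))) *\<^sub>R
      (qcis I (- \<nu> * u * v) * fourier I (gauss_mult \<nu> (\<nu> * sqrt 2 * u) f) (\<nu> * sqrt 2 * v))"
proof -
  have "integrable lborel (\<lambda>x. qcis I ((\<nu> * sqrt 2 * v) * x) * gauss_mult \<nu> (\<nu> * sqrt 2 * u) f x)"
    by (intro integrable_qcis_mult I gauss_mult_integrable assms) simp
  then show ?thesis
    unfolding SB_lborel_def SB_kernel_mult_slice_point[OF I] fourier_def by simp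
qed

text \<open>The phase has norm 1, and the factor exp (\<nu> v^2) from the kernel cancels that part
  of the Fock weight. In v only the Fourier transform remains, unweighted, ready for
  Plancherel.\<close>

lemma SB_lborel_norm_square_slice_point:
  assumes "\<nu> > 0" and I: "I \<in> imag_units" and f: "square_integrable f"
  shows "(norm (SB_lborel \<nu> f (slice_point I (u, v))))\<^sup>2 * exp (- \<nu> * (norm (slice_point I (u, v)))\<^sup>2) =
    (\<nu> / pi) powr (3 / 2) * exp (- 2 * \<nu> * u\<^sup>2) *
      (norm (fourier I (gauss_mult \<nu> (\<nu> * sqrt 2 * u) f) (\<nu> * sqrt 2 * v)))\<^sup>2"
proof -
  have "((\<nu> / pi) powr (3 / 4))\<^sup>2 = (\<nu> / pi) powr (3 / 2)"
    by (simp add: power2_eq_square flip: powr_add)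
  moreover have "(exp (- (\<nu> / 2) * (u\<^sup>2 - v\<^sup>2)))\<^sup>2 * exp (- \<nu> * (u\<^sup>2 + v\<^sup>2)) = exp (- 2 * \<nu> * u\<^sup>2)"
    by (simp add: power2_eq_square[of "exp _"] algebra_simps flip: exp_add)
  ultimately show ?thesis
    by (simp add: SB_lborel_slice_point[OF assms] norm_slice_point[OF I] norm_mult I power_mult_distrib
        mult.assoc mult.left_commute[of _ "exp (- (\<nu> * _))"])
qed

text \<open>The factors are the square of the kernel constant, the 2 pi of Plancherel divided by the
  frequency scale \<nu> sqrt 2, and the Gaussian integral over u.\<close>

lemma SB_constant:
  assumes "\<nu> > 0"
  shows "(\<nu> / pi) powr (3 / 2) * (2 * pi / (\<nu> * sqrt 2)) * sqrt (pi / (2 * \<nu>)) = 1"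
proof -
  define r where "r = \<nu> / pi"
  have r: "r > 0" using assms by (simp add: r_def)
  have "r powr (3 / 2) = r * sqrt r"
    using r powr_add[of r 1 "1 / 2"] by (simp add: powr_half_sqrt)
  moreover have "2 * pi / (\<nu> * sqrt 2) = sqrt 2 / r"
    using assms by (simp add: r_def divide_simps)
  moreover have "sqrt (pi / (2 * \<nu>)) = 1 / (sqrt 2 * sqrt r)"
    by (simp add: r_def real_sqrt_divide real_sqrt_mult)
  ultimately show ?thesis using r by (simp add: r_def[symmetric])
qed

lemma slice_point_measurable [measurable]: "slice_point I \<in> borel_measurable borel"
  by (intro borel_measurable_continuous_onI) (auto simp: slice_point_def intro!: continuous_intros)

lemma SB_lborel_slice_measurable:
  assumes I: "I \<in> imag_units" and [measurable]: "f \<in> borel_measurable borel"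
  shows "(\<lambda>z. SB_lborel \<nu> f (slice_point I z)) \<in> borel_measurable borel"
proof -
  have "(\<lambda>z. SB_lborel \<nu> f (slice_point I (fst z, snd z))) \<in> borel_measurable (lborel \<Otimes>\<^sub>M lborel)"
    unfolding SB_lborel_def SB_kernel_slice_point[OF I] by measurable
  then show ?thesis by (simp add: lborel_prod)
qed

text \<open>Working with nonnegative integrals allows exchanging u and x before any integrability is
  known, and makes finiteness of the Fock norm part of the result.\<close>

lemma SB_lborel_isometry:
  assumes nu: "\<nu> > 0" and I: "I \<in> imag_units" and f: "square_integrable f"
  shows "(\<integral>\<^sup>+z. ennreal ((norm (SB_lborel \<nu> f (slice_point I z)))\<^sup>2 * exp (- \<nu> * (norm (slice_point I z))\<^sup>2)) \<partial>lborel) =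
    ennreal (\<integral>x. (norm (f x))\<^sup>2 \<partial>lborel)"
proof -
  note [measurable] = square_integrableD(1)[OF f] SB_lborel_slice_measurable[OF I]
  \<comment> \<open>The constants of the kernel and of Plancherel; the integral over u supplies the
    third factor of \<open>SB_constant\<close>.\<close>
  define K where "K = (\<nu> / pi) powr (3 / 2) * (2 * pi / (\<nu> * sqrt 2))"
  have K: "K \<ge> 0" using nu by (simp add: K_def)
  define g where "g u = gauss_mult \<nu> (\<nu> * sqrt 2 * u) f" for u
  have g1: "integrable lborel (g u)" and g2: "square_integrable (g u)" for u
    unfolding g_def by (intro gauss_mult_integrable gauss_mult_square_integrable nu f)+
  have inner_int: "(\<integral>\<^sup>+v. ennreal ((norm (SB_lborel \<nu> f (slice_point I (u, v))))\<^sup>2 *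
      exp (- \<nu> * (norm (slice_point I (u, v)))\<^sup>2)) \<partial>lborel) =
    (\<integral>\<^sup>+x. ennreal (K * (norm (f x))\<^sup>2 * exp (- (2 * \<nu>) * (u - x / sqrt 2)\<^sup>2)) \<partial>lborel)" for u
  proof -
    define c where "c = (\<nu> / pi) powr (3 / 2) * exp (- 2 * \<nu> * u\<^sup>2)"
    have c: "c \<ge> 0" by (simp add: c_def)
    let ?F = "\<lambda>v. ennreal ((norm (fourier I (g u) v))\<^sup>2)"
    note [measurable] = square_integrableD(1)[OF g2[of u]]
    have d: "\<nu> * sqrt 2 > 0" using nu by simp
    have "ennreal (\<nu> * sqrt 2) * (\<integral>\<^sup>+v. ?F (0 + \<nu> * sqrt 2 * v) \<partial>lborel) =
      ennreal (2 * pi * (\<integral>x. (norm (g u x))\<^sup>2 \<partial>lborel))"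
      using nn_integral_real_affine[of ?F "\<nu> * sqrt 2" 0] assms(1) plancherel_quat[OF I g1 g2] by simp
    \<comment> \<open>Multiplying by the reciprocal removes the Jacobian of the frequency scaling,
      in extended nonnegative reals.\<close>
    then have "ennreal (1 / (\<nu> * sqrt 2)) * (ennreal (\<nu> * sqrt 2) * (\<integral>\<^sup>+v. ?F (\<nu> * sqrt 2 * v) \<partial>lborel)) =
      ennreal (1 / (\<nu> * sqrt 2)) * ennreal (2 * pi * (\<integral>x. (norm (g u x))\<^sup>2 \<partial>lborel))"
      by simp
    then have scaled: "(\<integral>\<^sup>+v. ?F (\<nu> * sqrt 2 * v) \<partial>lborel) =
      ennreal (2 * pi / (\<nu> * sqrt 2) * (\<integral>x. (norm (g u x))\<^sup>2 \<partial>lborel))"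
      using d nu by (simp add: mult.assoc[symmetric] flip: ennreal_mult)
    have "(\<integral>\<^sup>+v. ennreal ((norm (SB_lborel \<nu> f (slice_point I (u, v))))\<^sup>2 *
        exp (- \<nu> * (norm (slice_point I (u, v)))\<^sup>2)) \<partial>lborel) =
      (\<integral>\<^sup>+v. ennreal c * ?F (\<nu> * sqrt 2 * v) \<partial>lborel)"
      unfolding SB_lborel_norm_square_slice_point[OF nu I f] g_def[symmetric] c_def[symmetric]
      using c by (simp add: ennreal_mult)
    also have "\<dots> = ennreal c * ennreal (2 * pi / (\<nu> * sqrt 2) * (\<integral>x. (norm (g u x))\<^sup>2 \<partial>lborel))"
      by (subst nn_integral_cmult) (measurable, simp only: scaled)
    also have "\<dots> = ennreal (\<integral>x. c * (2 * pi / (\<nu> * sqrt 2)) * (norm (g u x))\<^sup>2 \<partial>lborel)"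
      using c d by (simp add: ennreal_mult[symmetric] mult.assoc)
    also have "\<dots> = (\<integral>\<^sup>+x. ennreal (c * (2 * pi / (\<nu> * sqrt 2)) * (norm (g u x))\<^sup>2) \<partial>lborel)"
      using c d square_integrableD(2)[OF g2[of u]] by (intro nn_integral_eq_integral[symmetric]) auto
    also have "\<dots> = (\<integral>\<^sup>+x. ennreal (K * (norm (f x))\<^sup>2 * exp (- (2 * \<nu>) * (u - x / sqrt 2)\<^sup>2)) \<partial>lborel)"
    proof (intro nn_integral_cong arg_cong[where f=ennreal])
      fix x
      \<comment> \<open>The weight in u and the squared Gaussian in x combine into one square. The
        shift x / sqrt 2 disappears on integrating over u, so every x receives the same
        constant.\<close>
      have "exp (- 2 * \<nu> * u\<^sup>2) * (exp (- (\<nu> / 2) * x\<^sup>2 + \<nu> * sqrt 2 * u * x))\<^sup>2 =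
        exp (- (2 * \<nu>) * (u - x / sqrt 2)\<^sup>2)"
      proof -
        have "x / sqrt 2 = sqrt 2 * x / 2" by (simp add: divide_simps)
        then have "(x / sqrt 2)\<^sup>2 = x\<^sup>2 / 2" "u * (x / sqrt 2) = sqrt 2 * u * x / 2"
          by (simp_all only: power_mult_distrib power_divide) simp_all
        then have "- 2 * \<nu> * u\<^sup>2 + 2 * (- (\<nu> / 2) * x\<^sup>2 + \<nu> * sqrt 2 * u * x) =
          - (2 * \<nu>) * (u - x / sqrt 2)\<^sup>2"
          unfolding power2_diff by (simp add: algebra_simps)
        then show ?thesis by (simp only: exp_double[symmetric] exp_add[symmetric])
      qed
      then show "c * (2 * pi / (\<nu> * sqrt 2)) * (norm (g u x))\<^sup>2 =
        K * (norm (f x))\<^sup>2 * exp (- (2 * \<nu>) * (u - x / sqrt 2)\<^sup>2)"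
        by (simp add: c_def K_def g_def gauss_mult_def power_mult_distrib) 
    qed
    finally show ?thesis .
  qed
  have outer_int: "(\<integral>\<^sup>+u. ennreal (K * (norm (f x))\<^sup>2 * exp (- (2 * \<nu>) * (u - x / sqrt 2)\<^sup>2)) \<partial>lborel) =
    ennreal ((norm (f x))\<^sup>2)" for x
  proof -
    have "has_bochner_integral lborel (\<lambda>u. K * (norm (f x))\<^sup>2 * exp (- (2 * \<nu>) * (u - x / sqrt 2)\<^sup>2))
      (K * (norm (f x))\<^sup>2 * sqrt (pi / (2 * \<nu>)))"
      using nu by (intro has_bochner_integral_mult_right integral_exp_minus_square) auto
    moreover have "K * (norm (f x))\<^sup>2 * sqrt (pi / (2 * \<nu>)) = (norm (f x))\<^sup>2"
      using SB_constant[OF nu] by (simp add: K_def mult.assoc mult.left_commute[of _ "(norm (f x))\<^sup>2"])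
    ultimately show ?thesis
      using K by (subst nn_integral_eq_integral) (auto simp: has_bochner_integral_iff)
  qed
  have "(\<integral>\<^sup>+z. ennreal ((norm (SB_lborel \<nu> f (slice_point I z)))\<^sup>2 * exp (- \<nu> * (norm (slice_point I z))\<^sup>2)) \<partial>lborel) =
    (\<integral>\<^sup>+u. (\<integral>\<^sup>+v. ennreal ((norm (SB_lborel \<nu> f (slice_point I (u, v))))\<^sup>2 *
      exp (- \<nu> * (norm (slice_point I (u, v)))\<^sup>2)) \<partial>lborel) \<partial>lborel)"
    unfolding lborel_prod[symmetric]
    by (subst lborel.nn_integral_fst) (simp_all add: lborel_prod)
  also have "\<dots> = (\<integral>\<^sup>+u. (\<integral>\<^sup>+x. ennreal (K * (norm (f x))\<^sup>2 * exp (- (2 * \<nu>) * (u - x / sqrt 2)\<^sup>2)) \<partial>lborel) \<partial>lborel)"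
    by (simp only: inner_int)
  also have "\<dots> = (\<integral>\<^sup>+x. (\<integral>\<^sup>+u. ennreal (K * (norm (f x))\<^sup>2 * exp (- (2 * \<nu>) * (u - x / sqrt 2)\<^sup>2)) \<partial>lborel) \<partial>lborel)"
    by (rule lborel_pair.Fubini') measurable
  also have "\<dots> = (\<integral>\<^sup>+x. ennreal ((norm (f x))\<^sup>2) \<partial>lborel)"
    by (simp only: outer_int)
  also have "\<dots> = ennreal (\<integral>x. (norm (f x))\<^sup>2 \<partial>lborel)"
    using square_integrableD(2)[OF f] by (intro nn_integral_eq_integral) auto
  finally show ?thesis .
qed

section \<open>Slice regularity\<close>

text \<open>
  Only the directions h commuting with q matter: at a point of the slice of \<open>I\<close> these include 1 and
  \<open>I\<close>, and the values of D at these two directions give the Cauchy-Riemann equation.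
\<close>

definition slice_entire :: "(quat \<Rightarrow> quat) \<Rightarrow> (quat \<Rightarrow> quat) \<Rightarrow> bool"
  where "slice_entire F F' \<longleftrightarrow> continuous_on UNIV F' \<and>
    (\<forall>q. \<exists>D. (F has_derivative D) (at q) \<and> (\<forall>h. h * q = q * h \<longrightarrow> D h = h * F' q))"

lemma slice_entire_imp_slice_regular:
  assumes F: "slice_entire F F'"
  shows "slice_regular F"
  unfolding slice_regular_def
proof (intro conjI allI ballI)
  show "F differentiable (at q)" for q
    using F by (auto simp: slice_entire_def differentiable_def)
next
  fix I assume I: "I \<in> imag_units"
  let ?fx = "\<lambda>z. F' (slice_point I z)"
  have c: "continuous_on UNIV F'" using F by (simp add: slice_entire_def)
  have cs: "continuous_on UNIV (slice_point I)"
    unfolding slice_point_def by (intro continuous_intros)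
  have fx: "continuous_on UNIV ?fx"
    by (rule continuous_on_compose2[OF c cs]) simp
  have "\<exists>fy. continuous_on UNIV ?fx \<and> continuous_on UNIV fy \<and>
     (\<forall>x y. ((\<lambda>s. F (slice_point I (s, y))) has_vector_derivative ?fx (x, y)) (at x) \<and>
        ((\<lambda>t. F (slice_point I (x, t))) has_vector_derivative fy (x, y)) (at y) \<and>
        (1 / 2) * (?fx (x, y) + I * fy (x, y)) = 0)"
  proof (intro exI[of _ "\<lambda>z. I * ?fx z"] conjI allI)
    fix x y
    have comm: "I * slice_point I (x, y) = slice_point I (x, y) * I"
      by (simp add: slice_point_def algebra_simps of_real_def)
    obtain D where D: "(F has_derivative D) (at (slice_point I (x, y)))"
      "\<And>h. h * slice_point I (x, y) = slice_point I (x, y) * h \<Longrightarrow> D h = h * ?fx (x, y)"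
      using F unfolding slice_entire_def by blast
    interpret D: bounded_linear D by (rule has_derivative_bounded_linear[OF D(1)])
    have "((\<lambda>s. slice_point I (s, y)) has_derivative (\<lambda>h. h *\<^sub>R 1)) (at x)"
      unfolding slice_point_def of_real_def by (auto intro!: derivative_eq_intros)
    from has_derivative_compose[OF this D(1)] show
      "((\<lambda>s. F (slice_point I (s, y))) has_vector_derivative ?fx (x, y)) (at x)"
      by (simp add: has_vector_derivative_def D.scaleR D(2))
    have "((\<lambda>t. slice_point I (x, t)) has_derivative (\<lambda>h. h *\<^sub>R I)) (at y)"
      unfolding slice_point_def of_real_def by (auto intro!: derivative_eq_intros)
    from has_derivative_compose[OF this D(1)] show
      "((\<lambda>t. F (slice_point I (x, t))) has_vector_derivative I * ?fx (x, y)) (at y)"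
      by (simp add: has_vector_derivative_def D.scaleR D(2)[OF comm])
    have "I * (I * ?fx (x, y)) = - ?fx (x, y)"
      using imag_unitsD(3)[OF I] by (simp flip: mult.assoc)
    then show "(1 / 2) * (?fx (x, y) + I * (I * ?fx (x, y))) = 0" by simp
  qed (intro fx continuous_intros)+
  then show "\<exists>fx fy. continuous_on UNIV fx \<and> continuous_on UNIV fy \<and>
     (\<forall>x y. ((\<lambda>s. F (slice_point I (s, y))) has_vector_derivative fx (x, y)) (at x) \<and>
        ((\<lambda>t. F (slice_point I (x, t))) has_vector_derivative fy (x, y)) (at y) \<and>
        (1 / 2) * (fx (x, y) + I * fy (x, y)) = 0)" by blast
qed

lemma slice_entire_continuous:
  assumes "slice_entire F F'"
  shows "continuous_on UNIV F"
  using assms unfolding slice_entire_def continuous_on_eq_continuous_at[OF open_UNIV]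
  by (metis has_derivative_continuous)

section \<open>Power series with right coefficients\<close>

primrec qpower_deriv :: "nat \<Rightarrow> quat \<Rightarrow> quat \<Rightarrow> quat" where
  "qpower_deriv 0 q h = 0"
| "qpower_deriv (Suc n) q h = q * qpower_deriv n q h + h * q ^ n"

text \<open>Leibniz rule for q * q^n. Unrolled, \<open>qpower_deriv n q h\<close> is the sum of q^i
  h q^(n-1-i) over i < n. All directions h are needed because \<open>slice_regular\<close> asks for
  real differentiability.\<close>

lemma has_derivative_qpower: "((\<lambda>q. q ^ n) has_derivative qpower_deriv n q) (at q)"
proof (induction n)
  case (Suc n)
  from has_derivative_mult[OF has_derivative_ident this] show ?case
    by (simp add: fun_eq_iff has_derivative_eq_rhs)
qed (simp add: fun_eq_iff has_derivative_eq_rhs)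

lemma norm_qpower_deriv_le: "norm (qpower_deriv n q h) \<le> real n * norm q ^ (n - 1) * norm h"
proof (induction n)
  case (Suc n)
  have "norm (qpower_deriv (Suc n) q h) \<le> norm q * norm (qpower_deriv n q h) + norm h * norm q ^ n"
    using norm_triangle_ineq[of "q * qpower_deriv n q h" "h * q ^ n"] by (simp add: norm_mult norm_power)
  also have "\<dots> \<le> norm q * (real n * norm q ^ (n - 1) * norm h) + norm h * norm q ^ n"
    by (intro add_right_mono mult_left_mono Suc) auto
  \<comment> \<open>At n = 0 the truncated n - 1 does no harm, being multiplied by
    \<open>real n\<close>.\<close>
  also have "\<dots> = real (Suc n) * norm q ^ (Suc n - 1) * norm h"
    by (cases n) (auto simp: algebra_simps)
  finally show ?case .
qed simp

text \<open>All n summands q^i h q^(n-1-i) coincide once h can be moved to the left.\<close>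

lemma qpower_deriv_commuting:
  assumes "h * q = q * h"
  shows "qpower_deriv n q h = h * (real n *\<^sub>R q ^ (n - 1))"
proof (induction n)
  case (Suc n)
  have "qpower_deriv (Suc n) q h = q * (h * (real n *\<^sub>R q ^ (n - 1))) + h * q ^ n"
    by (simp add: Suc)
  also have "q * (h * (real n *\<^sub>R q ^ (n - 1))) = h * (real n *\<^sub>R (q * q ^ (n - 1)))"
    by (simp add: assms flip: mult.assoc)
  also have "h * (real n *\<^sub>R (q * q ^ (n - 1))) + h * q ^ n = h * (real (Suc n) *\<^sub>R q ^ (Suc n - 1))"
    by (cases n) (auto simp: algebra_simps scaleR_2)
  finally show ?case .
qed simp

text \<open>Infinite radius of convergence, phrased through real series that serve directly as
  majorants of the quaternionic ones.\<close>

definition entire_coeffs :: "(nat \<Rightarrow> quat) \<Rightarrow> bool"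
  where "entire_coeffs c \<longleftrightarrow> (\<forall>r\<ge>0. summable (\<lambda>n. norm (c n) * r ^ n))"

lemma entire_coeffs_summable:
  assumes "entire_coeffs c"
  shows "summable (\<lambda>n. q ^ n * c n)"
proof (rule summable_norm_cancel)
  show "summable (\<lambda>n. norm (q ^ n * c n))"
    using assms[unfolded entire_coeffs_def, rule_format, of "norm q"]
    by (simp add: norm_mult norm_power mult.commute)
qed

text \<open>The factor n is at most 2^n and is absorbed by enlarging the radius. Passing to r + 1
  also covers the missing power of r when r < 1.\<close>

lemma entire_coeffs_deriv_bound:
  assumes c: "entire_coeffs c" and r: "r \<ge> 0"
  shows "summable (\<lambda>n. real n * r ^ (n - 1) * norm (c n))"
proof (rule summable_comparison_test)
  show "summable (\<lambda>n. norm (c n) * (2 * (r + 1)) ^ n)"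
    using c r by (simp add: entire_coeffs_def)
  have "real n * r ^ (n - 1) * norm (c n) \<le> norm (c n) * (2 * (r + 1)) ^ n" for n
  proof -
    have "real n \<le> 2 ^ n" by (metis less_imp_le of_nat_less_two_power)
    moreover have "r ^ (n - 1) \<le> (r + 1) ^ n"
    proof -
      have "r ^ (n - 1) \<le> (r + 1) ^ (n - 1)" using r by (intro power_mono) auto
      also have "\<dots> \<le> (r + 1) ^ n" using r by (intro power_increasing) auto
      finally show ?thesis .
    qed
    ultimately have "real n * r ^ (n - 1) \<le> 2 ^ n * (r + 1) ^ n"
      using r by (intro mult_mono) auto
    then have "real n * r ^ (n - 1) * norm (c n) \<le> 2 ^ n * (r + 1) ^ n * norm (c n)"
      by (rule mult_right_mono) simp
    then show ?thesis by (simp only: power_mult_distrib mult_ac)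
  qed
  then show "\<exists>N. \<forall>n\<ge>N. norm (real n * r ^ (n - 1) * norm (c n)) \<le> norm (c n) * (2 * (r + 1)) ^ n"
    using r by auto
qed

text \<open>Termwise differentiation needs the derivatives to converge uniformly as operators; the
  tails of the real series \<open>?b\<close> bound the error for all points of the ball and all h at
  once.\<close>

lemma power_series_has_derivative:
  assumes c: "entire_coeffs c"
  shows "((\<lambda>q. \<Sum>n. q ^ n * c n) has_derivative (\<lambda>h. \<Sum>n. qpower_deriv n q h * c n)) (at q)"
proof -
  define R where "R = norm q + 1"
  have R: "R \<ge> 0" "q \<in> ball 0 R" by (auto simp: R_def)
  let ?b = "\<lambda>n. real n * R ^ (n - 1) * norm (c n)"
  note sb = entire_coeffs_deriv_bound[OF c R(1)]
  have bnd: "norm (qpower_deriv n p h * c n) \<le> ?b n * norm h" if "p \<in> ball 0 R" for n p h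
  proof -
    have "norm (qpower_deriv n p h) \<le> real n * norm p ^ (n - 1) * norm h"
      by (rule norm_qpower_deriv_le)
    also have "\<dots> \<le> real n * R ^ (n - 1) * norm h"
      using that by (intro mult_right_mono mult_left_mono power_mono) auto
    finally have "norm (qpower_deriv n p h) * norm (c n) \<le> real n * R ^ (n - 1) * norm h * norm (c n)"
      by (rule mult_right_mono) simp
    then show ?thesis by (simp add: norm_mult algebra_simps)
  qed
  have sum: "summable (\<lambda>n. norm (qpower_deriv n p h * c n))" if "p \<in> ball 0 R" for p h
    by (rule summable_comparison_test[OF _ summable_mult2[OF sb, of "norm h"]])
       (use bnd[OF that] in auto)
  have "\<exists>g. \<forall>x\<in>ball 0 R. (\<lambda>n. x ^ n * c n) sums g x \<and>
    (g has_derivative (\<lambda>h. \<Sum>n. qpower_deriv n x h * c n)) (at x within ball 0 R)"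
  proof (rule has_derivative_series[where x=q and f'="\<lambda>n x h. qpower_deriv n x h * c n"])
    show "((\<lambda>x. x ^ n * c n) has_derivative (\<lambda>h. qpower_deriv n x h * c n)) (at x within ball 0 R)" for n x
      using has_derivative_mult_left[OF has_derivative_qpower[of n x], of "c n"]
      by (rule has_derivative_at_withinI)
    show "\<forall>\<^sub>F n in sequentially. \<forall>x\<in>ball 0 R. \<forall>h.
      norm ((\<Sum>i<n. qpower_deriv i x h * c i) - (\<Sum>n. qpower_deriv n x h * c n)) \<le> e * norm h"
      if e: "e > 0" for e
    proof -
      obtain N where N: "\<And>n. n \<ge> N \<Longrightarrow> norm (\<Sum>i. ?b (i + n)) < e"
        using suminf_exist_split[OF e sb] by auto
      have "norm ((\<Sum>i<n. qpower_deriv i x h * c i) - (\<Sum>n. qpower_deriv n x h * c n)) \<le> e * norm h"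
        if n: "n \<ge> N" and x: "x \<in> ball 0 R" for n x h
      proof -
        let ?t = "\<lambda>i. qpower_deriv i x h * c i"
        note s = sum[OF x, of h]
        have s': "summable (\<lambda>i. norm (?t (i + n)))" using s by (subst summable_iff_shift)
        have sb': "summable (\<lambda>i. ?b (i + n))" using sb by (subst summable_iff_shift)
        have "(\<Sum>i<n. ?t i) - (\<Sum>i. ?t i) = - (\<Sum>i. ?t (i + n))"
          using suminf_split_initial_segment[OF summable_norm_cancel[OF s], of n] by simp
        then have "norm ((\<Sum>i<n. ?t i) - (\<Sum>i. ?t i)) = norm (\<Sum>i. ?t (i + n))" by simp
        also have "\<dots> \<le> (\<Sum>i. norm (?t (i + n)))" by (rule summable_norm[OF s'])
        also have "\<dots> \<le> (\<Sum>i. ?b (i + n) * norm h)"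
          by (intro suminf_le bnd[OF x] s' summable_mult2 sb')
        also have "\<dots> = (\<Sum>i. ?b (i + n)) * norm h"
          by (rule suminf_mult2[symmetric, OF sb'])
        also have "\<dots> \<le> e * norm h"
          using N[OF n] by (intro mult_right_mono) auto
        finally show ?thesis .
      qed
      then show ?thesis unfolding eventually_sequentially by blast
    qed
    show "(\<lambda>n. q ^ n * c n) sums (\<Sum>n. q ^ n * c n)"
      by (rule summable_sums[OF entire_coeffs_summable[OF c]])
  qed (use R in auto)
  then obtain g where g: "\<And>x. x \<in> ball 0 R \<Longrightarrow> (\<lambda>n. x ^ n * c n) sums g x"
    "\<And>x. x \<in> ball 0 R \<Longrightarrow> (g has_derivative (\<lambda>h. \<Sum>n. qpower_deriv n x h * c n)) (at x within ball 0 R)"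
    by blast
  have "(g has_derivative (\<lambda>h. \<Sum>n. qpower_deriv n q h * c n)) (at q)"
    using g(2)[OF R(2)] at_within_open[OF R(2) open_ball] by simp
  then show ?thesis
    by (rule has_derivative_transform_within_open[OF _ open_ball R(2)]) (use g(1) sums_unique in auto)
qed

text \<open>As the coefficients stand on the right, an h commuting with q can be taken out of every
  term on the far left.\<close>

lemma power_series_slice_entire:
  assumes c: "entire_coeffs c"
  shows "slice_entire (\<lambda>q. \<Sum>n. q ^ n * c n) (\<lambda>q. \<Sum>n. q ^ n * (real (Suc n) *\<^sub>R c (Suc n)))"
proof -
  have c': "entire_coeffs (\<lambda>n. real (Suc n) *\<^sub>R c (Suc n))"
    unfolding entire_coeffs_def
  proof (intro allI impI)
    fix r :: real assume "r \<ge> 0"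
    from entire_coeffs_deriv_bound[OF c this]
    have "summable (\<lambda>n. real (Suc n) * r ^ (Suc n - 1) * norm (c (Suc n)))"
      by (subst summable_Suc_iff)
    then show "summable (\<lambda>n. norm (real (Suc n) *\<^sub>R c (Suc n)) * r ^ n)" by (simp add: mult_ac)
  qed
  have "continuous_on UNIV (\<lambda>q. \<Sum>n. q ^ n * (real (Suc n) *\<^sub>R c (Suc n)))"
    using has_derivative_continuous[OF power_series_has_derivative[OF c']]
    by (simp add: continuous_on_eq_continuous_at)
  moreover have "(\<Sum>n. qpower_deriv n q h * c n) = h * (\<Sum>n. q ^ n * (real (Suc n) *\<^sub>R c (Suc n)))"
    if h: "h * q = q * h" for q h
  proof -
    have 1: "qpower_deriv (Suc n) q h * c (Suc n) = h * (q ^ n * (real (Suc n) *\<^sub>R c (Suc n)))" for n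
      by (simp only: qpower_deriv_commuting[OF h]) (simp add: mult.assoc)
    have s: "summable (\<lambda>n. qpower_deriv (Suc n) q h * c (Suc n))"
      unfolding 1 by (intro summable_mult entire_coeffs_summable[OF c'])
    \<comment> \<open>The constant term has derivative 0, so the index may start at 1.\<close>
    have "(\<Sum>n. qpower_deriv n q h * c n) = (\<Sum>n. qpower_deriv (Suc n) q h * c (Suc n))"
      using suminf_split_head[of "\<lambda>n. qpower_deriv n q h * c n"] s
      by (simp only: summable_Suc_iff[of "\<lambda>n. qpower_deriv n q h * c n"]) simp
    then show ?thesis
      unfolding 1 by (simp only: suminf_mult[OF entire_coeffs_summable[OF c']])
  qed
  ultimately show ?thesis
    unfolding slice_entire_def using power_series_has_derivative[OF c] by blast
qed

section \<open>The exponential of a multiple of the square\<close>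

lemma slice_entire_exp: "slice_entire (exp :: quat \<Rightarrow> quat) exp"
proof -
  have "entire_coeffs (\<lambda>n. 1 /\<^sub>R fact n)"
    unfolding entire_coeffs_def using summable_exp_generic[where 'a=real]
    by (simp add: divide_inverse mult.commute)
  from power_series_slice_entire[OF this]
  have "slice_entire exp (\<lambda>q. \<Sum>n. q ^ n * (real (Suc n) *\<^sub>R (1 /\<^sub>R fact (Suc n))))"
    by (simp add: exp_def)
  also have "(\<lambda>q. \<Sum>n. q ^ n * (real (Suc n) *\<^sub>R (1 /\<^sub>R fact (Suc n)))) = (exp :: quat \<Rightarrow> quat)"
    unfolding exp_def by (intro ext suminf_cong) (simp del: of_nat_Suc)
  finally show ?thesis .
qed

lemma exp_commuting:
  fixes p h :: quat
  assumes "h * p = p * h"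
  shows "h * exp p = exp p * h"
proof -
  have "h * exp p = (\<Sum>n. h * (p ^ n /\<^sub>R fact n))"
    unfolding exp_def by (rule suminf_mult[symmetric, OF summable_exp_generic])
  also have "\<dots> = (\<Sum>n. (p ^ n /\<^sub>R fact n) * h)"
    using power_commuting_commutes[OF assms[symmetric]] by simp
  also have "\<dots> = exp p * h"
    unfolding exp_def by (rule suminf_mult2[symmetric, OF summable_exp_generic])
  finally show ?thesis .
qed

text \<open>For h commuting with q the inner derivative is 2 a h q. It commutes with a q^2, so it is
  an admissible direction for the exponential at that point.\<close>

lemma slice_entire_exp_square:
  "slice_entire (\<lambda>q. exp (a *\<^sub>R q\<^sup>2)) (\<lambda>q. exp (a *\<^sub>R q\<^sup>2) * ((2 * a) *\<^sub>R q))"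
  unfolding slice_entire_def
proof (intro conjI allI)
  show "continuous_on UNIV (\<lambda>q::quat. exp (a *\<^sub>R q\<^sup>2) * ((2 * a) *\<^sub>R q))"
    by (intro continuous_intros continuous_on_compose2[OF slice_entire_continuous[OF slice_entire_exp]]) auto
  fix q :: quat
  obtain D where D: "(exp has_derivative D) (at (a *\<^sub>R q\<^sup>2))"
    "\<And>h. h * (a *\<^sub>R q\<^sup>2) = (a *\<^sub>R q\<^sup>2) * h \<Longrightarrow> D h = h * exp (a *\<^sub>R q\<^sup>2)"
    using slice_entire_exp unfolding slice_entire_def by blast
  have "((\<lambda>q. a *\<^sub>R q\<^sup>2) has_derivative (\<lambda>h. a *\<^sub>R (q * h + h * q))) (at q)"
    unfolding power2_eq_square by (auto intro!: derivative_eq_intros)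
  from has_derivative_compose[OF this D(1)]
  have "((\<lambda>q. exp (a *\<^sub>R q\<^sup>2)) has_derivative (\<lambda>h. D (a *\<^sub>R (q * h + h * q)))) (at q)" .
  moreover have "D (a *\<^sub>R (q * h + h * q)) = h * (exp (a *\<^sub>R q\<^sup>2) * ((2 * a) *\<^sub>R q))" if h: "h * q = q * h" for h
  proof -
    have e: "a *\<^sub>R (q * h + h * q) = (2 * a) *\<^sub>R (h * q)"
      using h by (simp add: mult.commute flip: scaleR_2)
    have "(h * q) * q\<^sup>2 = q\<^sup>2 * (h * q)"
      using h by (simp add: power2_eq_square) (metis mult.assoc)
    then have "((2 * a) *\<^sub>R (h * q)) * (a *\<^sub>R q\<^sup>2) = (a *\<^sub>R q\<^sup>2) * ((2 * a) *\<^sub>R (h * q))"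
      by simp
    note D(2)[OF this]
    moreover have "q * exp (a *\<^sub>R q\<^sup>2) = exp (a *\<^sub>R q\<^sup>2) * q"
      by (rule exp_commuting) (simp add: power2_eq_square mult.assoc)
    ultimately show ?thesis
      by (simp add: e mult.assoc)
  qed
  ultimately show "\<exists>D. ((\<lambda>q. exp (a *\<^sub>R q\<^sup>2)) has_derivative D) (at q) \<and>
    (\<forall>h. h * q = q * h \<longrightarrow> D h = h * (exp (a *\<^sub>R q\<^sup>2) * ((2 * a) *\<^sub>R q)))" by blast
qed

text \<open>Products do not preserve \<open>slice_entire\<close> in general: left multiplication of
  q by a constant i already fails. Here the left factor commutes with every h that commutes with q,
  so h passes through it in the product rule.\<close>

lemma slice_entire_exp_square_mult:
  assumes F: "slice_entire F F'"
  shows "\<exists>G. slice_entire (\<lambda>q. exp (a *\<^sub>R q\<^sup>2) * F q) G"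
proof
  let ?E = "\<lambda>q::quat. exp (a *\<^sub>R q\<^sup>2)" and ?E' = "\<lambda>q::quat. exp (a *\<^sub>R q\<^sup>2) * ((2 * a) *\<^sub>R q)"
  note E = slice_entire_exp_square[of a]
  show "slice_entire (\<lambda>q. ?E q * F q) (\<lambda>q. ?E q * F' q + ?E' q * F q)"
    unfolding slice_entire_def
  proof (intro conjI allI)
    have "continuous_on UNIV F'" "continuous_on UNIV ?E'"
      using F E by (auto simp: slice_entire_def)
    then show "continuous_on UNIV (\<lambda>q. ?E q * F' q + ?E' q * F q)"
      using slice_entire_continuous[OF F] slice_entire_continuous[OF E] by (intro continuous_intros)
    fix q
    obtain D where D: "(F has_derivative D) (at q)" "\<And>h. h * q = q * h \<Longrightarrow> D h = h * F' q"
      using F unfolding slice_entire_def by blast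
    obtain C where C: "(?E has_derivative C) (at q)" "\<And>h. h * q = q * h \<Longrightarrow> C h = h * ?E' q"
      using E unfolding slice_entire_def by blast
    have "?E q * D h + C h * F q = h * (?E q * F' q + ?E' q * F q)" if h: "h * q = q * h" for h
    proof -
      have "h * ?E q = ?E q * h"
        using h by (intro exp_commuting) (simp add: power2_eq_square, metis mult.assoc)
      then have "?E q * (h * F' q) = h * (?E q * F' q)"
        by (metis mult.assoc)
      then show ?thesis by (simp add: C(2)[OF h] D(2)[OF h] distrib_left mult.assoc)
    qed
    then show "\<exists>D. ((\<lambda>q. ?E q * F q) has_derivative D) (at q) \<and>
      (\<forall>h. h * q = q * h \<longrightarrow> D h = h * (?E q * F' q + ?E' q * F q))"
      using has_derivative_mult[OF C(1) D(1)] by blast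
  qed
qed

section \<open>The power series of the transform\<close>

lemma exp_abs_linear_integrable:
  fixes f :: "real \<Rightarrow> quat"
  assumes nu: "\<nu> > 0" and f: "square_integrable f"
  shows "integrable lborel (\<lambda>x. exp (b * \<bar>x\<bar>) *\<^sub>R gauss_mult \<nu> 0 f x)"
proof (rule Bochner_Integration.integrable_bound)
  note [measurable] = square_integrableD(1)[OF f]
  show "(\<lambda>x. exp (b * \<bar>x\<bar>) *\<^sub>R gauss_mult \<nu> 0 f x) \<in> borel_measurable lborel"
    unfolding gauss_mult_def by measurable
  show "integrable lborel (\<lambda>x. norm (gauss_mult \<nu> b f x) + norm (gauss_mult \<nu> (- b) f x))"
    by (intro Bochner_Integration.integrable_add integrable_norm gauss_mult_integrable nu f)
  show "AE x in lborel. norm (exp (b * \<bar>x\<bar>) *\<^sub>R gauss_mult \<nu> 0 f x) \<le>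
    norm (norm (gauss_mult \<nu> b f x) + norm (gauss_mult \<nu> (- b) f x))"
  proof (rule AE_I2)
    fix x
    \<comment> \<open>exp (b |x|) is one of exp (b x) and exp (- b x), hence at most their
      sum.\<close>
    have "exp (b * \<bar>x\<bar>) * exp (- (\<nu> / 2) * x\<^sup>2 + 0 * x) \<le>
      exp (- (\<nu> / 2) * x\<^sup>2 + b * x) + exp (- (\<nu> / 2) * x\<^sup>2 + - b * x)"
      by (cases "x \<ge> 0") (auto simp: add.commute add_increasing add_increasing2 simp flip: exp_add)
    then have "exp (b * \<bar>x\<bar>) * exp (- (\<nu> / 2) * x\<^sup>2 + 0 * x) * norm (f x) \<le>
      (exp (- (\<nu> / 2) * x\<^sup>2 + b * x) + exp (- (\<nu> / 2) * x\<^sup>2 + - b * x)) * norm (f x)"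
      by (rule mult_right_mono) simp
    then show "norm (exp (b * \<bar>x\<bar>) *\<^sub>R gauss_mult \<nu> 0 f x) \<le>
      norm (norm (gauss_mult \<nu> b f x) + norm (gauss_mult \<nu> (- b) f x))"
      by (simp add: gauss_mult_def distrib_right mult.assoc)
  qed
qed

text \<open>Expand the factor exp (\<nu> sqrt 2 q x) of the kernel in powers of q and integrate
  termwise. The coefficients are, up to real constants, the moments of the Gaussian multiple of f,
  and remain to the right of q^n.\<close>

lemma SB_lborel_eq_power_series:
  assumes nu: "\<nu> > 0" and f: "square_integrable f"
  shows "\<exists>c. entire_coeffs c \<and>
    (\<forall>q. SB_lborel \<nu> f q = exp ((- \<nu> / 2) *\<^sub>R q\<^sup>2) * (\<Sum>n. q ^ n * c n))"
proof -
  note [measurable] = square_integrableD(1)[OF f]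
  define b where "b = \<nu> * sqrt 2"
  have b: "b > 0" using nu by (simp add: b_def)
  define k where "k = (\<nu> / pi) powr (3 / 4)"
  define g where "g = gauss_mult \<nu> 0 f"
  have [measurable]: "g \<in> borel_measurable borel"
    unfolding g_def gauss_mult_def[abs_def] by measurable
  define t where "t n x = (k * (b * x) ^ n / fact n) *\<^sub>R g x" for n x
  define c where "c n = (\<integral>x. t n x \<partial>lborel)" for n
  have k: "k \<ge> 0" by (simp add: k_def)
  \<comment> \<open>For r = |q| this majorizes all partial sums of norms simultaneously; r is
    arbitrary, hence the infinite radius of convergence.\<close>
  have dom: "integrable lborel (\<lambda>x. k * exp (r * b * \<bar>x\<bar>) * norm (g x))" for r
    using integrable_mult_right[OF integrable_norm[OF exp_abs_linear_integrable[OF nu f, of "r * b"]], of k]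
    by (simp add: g_def mult.assoc)
  have term_norm: "r ^ n * norm (t n x) = k * norm (g x) * ((r * b * \<bar>x\<bar>) ^ n / fact n)" if "r \<ge> 0" for r n x
    using that b k by (simp add: t_def abs_mult power_mult_distrib power_abs)
  have exp_sums: "(\<lambda>n. r ^ n * norm (t n x)) sums (k * norm (g x) * exp (r * b * \<bar>x\<bar>))" if "r \<ge> 0" for r x
    unfolding term_norm[OF that]
    using exp_converges[of "r * b * \<bar>x\<bar>"] by (intro sums_mult) (simp add: divide_inverse mult.commute)
  have partial: "(\<Sum>i<n. r ^ i * norm (t i x)) \<le> k * exp (r * b * \<bar>x\<bar>) * norm (g x)" if "r \<ge> 0" for r n x
    using sum_le_suminf[OF sums_summable[OF exp_sums[OF that]], of "{..<n}" x] sums_unique[OF exp_sums[OF that, of x]] that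
    by (simp add: mult_ac)
  have t_int: "integrable lborel (t n)" for n
  proof (rule Bochner_Integration.integrable_bound[OF dom[of 1]])
    show "AE x in lborel. norm (t n x) \<le> norm (k * exp (1 * b * \<bar>x\<bar>) * norm (g x))"
    proof (rule AE_I2)
      fix x
      have "norm (t n x) \<le> (\<Sum>i<Suc n. 1 ^ i * norm (t i x))"
        by (simp add: sum_nonneg)
      also have "\<dots> \<le> k * exp (1 * b * \<bar>x\<bar>) * norm (g x)" by (rule partial) simp
      finally show "norm (t n x) \<le> norm (k * exp (1 * b * \<bar>x\<bar>) * norm (g x))"
        using k by simp
    qed
  qed (unfold t_def, measurable)
  have sum_int: "summable (\<lambda>n. r ^ n * (\<integral>x. norm (t n x) \<partial>lborel))" if r: "r \<ge> 0" for r
  proof (rule summableI_nonneg_bounded)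
    fix n
    have "(\<Sum>i<n. r ^ i * (\<integral>x. norm (t i x) \<partial>lborel)) = (\<integral>x. (\<Sum>i<n. r ^ i * norm (t i x)) \<partial>lborel)"
      using t_int by (subst Bochner_Integration.integral_sum) auto
    also have "\<dots> \<le> (\<integral>x. k * exp (r * b * \<bar>x\<bar>) * norm (g x) \<partial>lborel)"
      by (intro integral_mono dom partial r Bochner_Integration.integrable_sum) (use t_int in auto)
    finally show "(\<Sum>i<n. r ^ i * (\<integral>x. norm (t i x) \<partial>lborel)) \<le> (\<integral>x. k * exp (r * b * \<bar>x\<bar>) * norm (g x) \<partial>lborel)" .
  qed (use r in auto)
  have "entire_coeffs c"
    unfolding entire_coeffs_def
  proof (intro allI impI)
    fix r :: real assume r: "r \<ge> 0"
    show "summable (\<lambda>n. norm (c n) * r ^ n)"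
    proof (rule summable_comparison_test[OF _ sum_int[OF r]])
      show "\<exists>N. \<forall>n\<ge>N. norm (norm (c n) * r ^ n) \<le> r ^ n * (\<integral>x. norm (t n x) \<partial>lborel)"
        using r by (intro exI[of _ 0])
          (auto simp: c_def abs_mult mult.commute intro!: mult_left_mono integral_norm_bound)
    qed
  qed
  moreover have "SB_lborel \<nu> f q = exp ((- \<nu> / 2) *\<^sub>R q\<^sup>2) * (\<Sum>n. q ^ n * c n)" for q
  proof -
    have kernel: "SB_kernel \<nu> q x * f x = exp ((- \<nu> / 2) *\<^sub>R q\<^sup>2) * (\<Sum>n. q ^ n * t n x)" for x
    proof -
      let ?A = "(- \<nu> / 2) *\<^sub>R q\<^sup>2" and ?B = "of_real (- (\<nu> / 2) * x\<^sup>2) :: quat" and ?C = "(b * x) *\<^sub>R q"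
      \<comment> \<open>\<open>?B\<close> is real, and \<open>?A\<close> and \<open>?C\<close> are
        real multiples of powers of q, so the three exponents commute and the exponential factors.
        The factor from \<open>?B\<close> is the Gaussian inside \<open>g\<close>.\<close>
      have e1: "- of_real (\<nu> / 2) * (q\<^sup>2 + of_real (x\<^sup>2)) + of_real (\<nu> * sqrt 2) * q * of_real x = ?A + (?B + ?C)"
        by (simp add: of_real_def b_def algebra_simps)
      have e2: "exp (?A + (?B + ?C)) = exp ?A * (exp ?B * exp ?C)"
        by (subst exp_add_commuting, simp add: of_real_def power2_eq_square algebra_simps)
          (subst exp_add_commuting, simp_all add: of_real_def)
      have e3: "exp ?B = exp (- (\<nu> / 2) * x\<^sup>2) *\<^sub>R 1"
        by (simp only: exp_of_real) (simp only: of_real_def)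
      have "SB_kernel \<nu> q x * f x = exp ?A * (exp ?C * (k *\<^sub>R g x))"
        unfolding SB_kernel_def e1 e2 e3 k_def[symmetric]
        by (simp add: g_def gauss_mult_def of_real_def mult.assoc)
      moreover have "(\<lambda>n. (?C ^ n /\<^sub>R fact n) * (k *\<^sub>R g x)) sums (exp ?C * (k *\<^sub>R g x))"
        by (intro sums_mult2 exp_converges)
      moreover have "(?C ^ n /\<^sub>R fact n) * (k *\<^sub>R g x) = q ^ n * t n x" for n
        by (simp add: t_def scaleR_power divide_inverse mult_ac)
      ultimately show ?thesis using sums_unique by (metis (no_types, lifting) sums_cong)
    qed
    have qt: "integrable lborel (\<lambda>x. q ^ n * t n x)" for n
      using t_int by simp
    have "(\<integral>x. (\<Sum>n. q ^ n * t n x) \<partial>lborel) = (\<Sum>n. \<integral>x. q ^ n * t n x \<partial>lborel)"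
    proof (rule integral_suminf[OF qt])
      show "AE x in lborel. summable (\<lambda>n. norm (q ^ n * t n x))"
        using sums_summable[OF exp_sums[of "norm q"]] by (simp add: norm_mult norm_power)
      show "summable (\<lambda>n. \<integral>x. norm (q ^ n * t n x) \<partial>lborel)"
        using sum_int[of "norm q"] by (simp add: norm_mult norm_power)
    qed
    moreover have "integrable lborel (\<lambda>x. \<Sum>n. q ^ n * t n x)"
    proof (rule integrable_suminf[OF qt])
      show "AE x in lborel. summable (\<lambda>n. norm (q ^ n * t n x))"
        using sums_summable[OF exp_sums[of "norm q"]] by (simp add: norm_mult norm_power)
      show "summable (\<lambda>n. \<integral>x. norm (q ^ n * t n x) \<partial>lborel)"
        using sum_int[of "norm q"] by (simp add: norm_mult norm_power)
    qed
    ultimately show ?thesis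
      unfolding SB_lborel_def kernel using t_int by (simp add: c_def)
  qed
  ultimately show ?thesis by blast
qed

lemma SB_lborel_slice_regular:
  assumes "\<nu> > 0" "square_integrable f"
  shows "slice_regular (SB_lborel \<nu> f)"
proof -
  obtain c where c: "entire_coeffs c"
    "\<And>q. SB_lborel \<nu> f q = exp ((- \<nu> / 2) *\<^sub>R q\<^sup>2) * (\<Sum>n. q ^ n * c n)"
    using SB_lborel_eq_power_series[OF assms] by blast
  obtain G where "slice_entire (\<lambda>q. exp ((- \<nu> / 2) *\<^sub>R q\<^sup>2) * (\<Sum>n. q ^ n * c n)) G"
    using slice_entire_exp_square_mult[OF power_series_slice_entire[OF c(1)]] by blast
  then have "slice_entire (SB_lborel \<nu> f) G" by (simp only: c(2)[abs_def])
  then show ?thesis by (rule slice_entire_imp_slice_regular)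
qed

section \<open>Inner products\<close>

lemma borel_measurable_lebesgue_eq_AE:
  fixes f :: "'a::euclidean_space \<Rightarrow> 'b::euclidean_space"
  assumes f: "f \<in> borel_measurable lebesgue"
  shows "\<exists>g\<in>borel_measurable borel. AE x in lebesgue. f x = g x"
proof -
  have "\<exists>g\<in>borel_measurable borel. AE x in lborel. inner (f x) e = g x" for e
    using completion_ex_borel_measurable_real[of "\<lambda>x. inner (f x) e" lborel] f by auto
  then obtain g where [measurable]: "\<And>e. g e \<in> borel_measurable borel"
    and g: "\<And>e. AE x in lborel. inner (f x) e = g e x" by metis
  \<comment> \<open>The real-valued case is applied to each coordinate; there are finitely many, so
    the exceptional sets unite to a null set.\<close>
  have "AE x in lborel. \<forall>e\<in>Basis. inner (f x) e = g e x"
    using g by (intro AE_finite_allI) auto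
  then have "AE x in lborel. f x = (\<Sum>e\<in>Basis. g e x *\<^sub>R e)"
  proof eventually_elim
    case (elim x)
    have "f x = (\<Sum>e\<in>Basis. inner (f x) e *\<^sub>R e)" by (rule euclidean_representation[symmetric])
    also have "\<dots> = (\<Sum>e\<in>Basis. g e x *\<^sub>R e)" using elim by (intro sum.cong) auto
    finally show ?case .
  qed
  then have "AE x in lebesgue. f x = (\<Sum>e\<in>Basis. g e x *\<^sub>R e)" by (rule AE_completion)
  moreover have "(\<lambda>x. \<Sum>e\<in>Basis. g e x *\<^sub>R e) \<in> borel_measurable borel" by measurable
  ultimately show ?thesis by (rule bexI)
qed

lemma L2_quat_square_integrable:
  assumes "f \<in> L2_quat"
  obtains f' where "square_integrable f'" "AE x in lebesgue. f x = f' x"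
proof -
  have f: "f \<in> borel_measurable lebesgue" "integrable lebesgue (\<lambda>t. (norm (f t))\<^sup>2)"
    using assms by (auto simp: L2_quat_def)
  obtain f' where [measurable]: "f' \<in> borel_measurable borel" and ae: "AE x in lebesgue. f x = f' x"
    using borel_measurable_lebesgue_eq_AE[OF f(1)] by blast
  have m: "f' \<in> borel_measurable lebesgue" by (simp add: measurable_completion)
  have "integrable lebesgue (\<lambda>t. (norm (f' t))\<^sup>2)"
  proof (rule integrable_cong_AE_imp[OF f(2)])
    show "(\<lambda>t. (norm (f' t))\<^sup>2) \<in> borel_measurable lebesgue" using m by measurable
    show "AE x in lebesgue. (norm (f x))\<^sup>2 = (norm (f' x))\<^sup>2" using ae by eventually_elim simp
  qed
  then have "integrable lborel (\<lambda>t. (norm (f' t))\<^sup>2)" by (simp add: integrable_completion)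
  then show thesis using ae by (intro that[of f']) (simp_all add: square_integrable_def)
qed

text \<open>Integration does not see null sets, so the two transforms agree at every q. Slice
  regularity, a pointwise notion, is therefore inherited.\<close>

lemma SB_transform_eq_SB_lborel:
  assumes f: "f \<in> L2_quat" and f': "square_integrable f'" and ae: "AE x in lebesgue. f x = f' x"
  shows "SB_transform \<nu> f = SB_lborel \<nu> f'"
proof
  fix q
  note [measurable] = square_integrableD(1)[OF f']
  have m: "f \<in> borel_measurable lebesgue" using f by (auto simp: L2_quat_def)
  have k: "SB_kernel \<nu> q \<in> borel_measurable lebesgue" by (simp add: measurable_completion)
  have m': "f' \<in> borel_measurable lebesgue" by (simp add: measurable_completion)
  have "SB_transform \<nu> f q = (LINT x|lebesgue. SB_kernel \<nu> q x * f' x)"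
    unfolding SB_transform_def
  proof (rule integral_cong_AE)
    show "(\<lambda>x. SB_kernel \<nu> q x * f x) \<in> borel_measurable lebesgue" using k m by measurable
    show "(\<lambda>x. SB_kernel \<nu> q x * f' x) \<in> borel_measurable lebesgue" using k m' by measurable
    show "AE x in lebesgue. SB_kernel \<nu> q x * f x = SB_kernel \<nu> q x * f' x"
      using ae by eventually_elim simp
  qed
  then show "SB_transform \<nu> f q = SB_lborel \<nu> f' q"
    by (simp add: SB_lborel_def integral_completion)
qed

lemma qcnj_measurable [measurable (raw)]:
  "f \<in> borel_measurable M \<Longrightarrow> (\<lambda>x. qcnj (f x)) \<in> borel_measurable M"
  by (rule borel_measurable_continuous_on[OF linear_continuous_on[OF bounded_linear_qcnj]])

lemma L2_inner_eq_lborel: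
  assumes f: "f \<in> L2_quat" and f': "square_integrable f'" and aef: "AE x in lebesgue. f x = f' x"
    and g: "g \<in> L2_quat" and g': "square_integrable g'" and aeg: "AE x in lebesgue. g x = g' x"
  shows "L2_inner f g = (\<integral>x. qcnj (g' x) * f' x \<partial>lborel)"
proof -
  note [measurable] = square_integrableD(1)[OF f'] square_integrableD(1)[OF g']
  have m: "f \<in> borel_measurable lebesgue" "g \<in> borel_measurable lebesgue"
    using f g by (auto simp: L2_quat_def)
  have m': "(\<lambda>x. qcnj (g' x) * f' x) \<in> borel_measurable lborel" by measurable
  have "L2_inner f g = (LINT x|lebesgue. qcnj (g' x) * f' x)"
    unfolding L2_inner_def
  proof (rule integral_cong_AE)
    show "(\<lambda>x. qcnj (g x) * f x) \<in> borel_measurable lebesgue" using m by measurable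
    show "(\<lambda>x. qcnj (g' x) * f' x) \<in> borel_measurable lebesgue" using m' by (rule measurable_completion)
    show "AE x in lebesgue. qcnj (g x) * f x = qcnj (g' x) * f' x"
      using aef aeg by eventually_elim simp
  qed
  then show ?thesis using m' by (simp add: integral_completion)
qed

section \<open>Polarization and recovery of the quaternionic inner product\<close>

lemma square_integrable_mult_right:
  fixes f :: "'a::euclidean_space \<Rightarrow> quat"
  assumes "square_integrable f"
  shows "square_integrable (\<lambda>x. f x * e)"
  using assms by (auto simp: square_integrable_def norm_mult power_mult_distrib intro!: borel_measurable_times)

lemma inner_polarization:
  fixes a b :: "'a::real_inner"
  shows "inner a b = ((norm (a + b))\<^sup>2 - (norm (a - b))\<^sup>2) / 4"
  by (simp add: power2_norm_eq_inner inner_add inner_diff inner_commute)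

lemma quat_eqI_inner:
  assumes "\<And>e. inner p e = inner q e"
  shows "p = (q :: quat)"
  using assms by (metis inner_eq_zero_iff inner_diff_left right_minus_eq)

text \<open>Left multiplication by b and by its conjugate are adjoint. Hence each component of the
  quaternionic inner product of f and g is a real inner product of f with some g e.\<close>

lemma inner_qcnj_mult: "inner (qcnj b * a) e = inner a (b * e)"
  by (simp add: inner_quat_def algebra_simps)

lemma integrable_qcnj_mult:
  fixes f g :: "'a::euclidean_space \<Rightarrow> quat"
  assumes f: "square_integrable f" and g: "square_integrable g"
  shows "integrable lborel (\<lambda>x. qcnj (g x) * f x)"
proof (rule Bochner_Integration.integrable_bound)
  note [measurable] = square_integrableD(1)[OF f] square_integrableD(1)[OF g]
  show "(\<lambda>x. qcnj (g x) * f x) \<in> borel_measurable lborel" by measurable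
  show "integrable lborel (\<lambda>x. ((norm (g x))\<^sup>2 + (norm (f x))\<^sup>2) / 2)"
    using square_integrableD(2)[OF f] square_integrableD(2)[OF g] by auto
  have "norm (qcnj q) = norm q" for q by (simp add: norm_quat_def)
  then show "AE x in lborel. norm (qcnj (g x) * f x) \<le> norm (((norm (g x))\<^sup>2 + (norm (f x))\<^sup>2) / 2)"
    using abs_inner_le[of "norm (g _)" "norm (f _)"] by (auto simp: norm_mult)
qed

text \<open>
  With half of the Gaussian weight moved into each factor, the Fock inner product on a slice becomes an
  unweighted inner product over the plane.
\<close>

definition SB_weighted :: "real \<Rightarrow> quat \<Rightarrow> (real \<Rightarrow> quat) \<Rightarrow> real \<times> real \<Rightarrow> quat"
  where "SB_weighted \<nu> I f z =
    exp (- \<nu> * (norm (slice_point I z))\<^sup>2 / 2) *\<^sub>R SB_lborel \<nu> f (slice_point I z)"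

lemma norm_SB_weighted:
  "(norm (SB_weighted \<nu> I f z))\<^sup>2 =
    (norm (SB_lborel \<nu> f (slice_point I z)))\<^sup>2 * exp (- \<nu> * (norm (slice_point I z))\<^sup>2)"
  by (simp add: SB_weighted_def power_mult_distrib mult.commute flip: exp_double)

lemma SB_weighted_isometry:
  assumes nu: "\<nu> > 0" and I: "I \<in> imag_units" and f: "square_integrable f"
  shows "square_integrable (SB_weighted \<nu> I f)"
    "(\<integral>z. (norm (SB_weighted \<nu> I f z))\<^sup>2 \<partial>lborel) = (\<integral>x. (norm (f x))\<^sup>2 \<partial>lborel)"
proof -
  note [measurable] = square_integrableD(1)[OF f] SB_lborel_slice_measurable[OF I]
  have [measurable]: "SB_weighted \<nu> I f \<in> borel_measurable borel"
    unfolding SB_weighted_def[abs_def] by measurable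
  have nn: "(\<integral>\<^sup>+z. ennreal ((norm (SB_weighted \<nu> I f z))\<^sup>2) \<partial>lborel) = ennreal (\<integral>x. (norm (f x))\<^sup>2 \<partial>lborel)"
    using SB_lborel_isometry[OF assms] by (simp only: norm_SB_weighted)
  have "integrable lborel (\<lambda>z. (norm (SB_weighted \<nu> I f z))\<^sup>2)"
    by (rule integrableI_nonneg) (auto simp: nn)
  then show "square_integrable (SB_weighted \<nu> I f)" by (simp add: square_integrable_def)
  show "(\<integral>z. (norm (SB_weighted \<nu> I f z))\<^sup>2 \<partial>lborel) = (\<integral>x. (norm (f x))\<^sup>2 \<partial>lborel)"
    by (subst integral_eq_nn_integral) (auto simp: nn)
qed

lemma SB_weighted_add_mult:
  assumes "\<nu> > 0" "square_integrable f" "square_integrable g"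
  shows "SB_weighted \<nu> I (\<lambda>x. f x + g x * e) z = SB_weighted \<nu> I f z + SB_weighted \<nu> I g z * e"
proof -
  have "SB_lborel \<nu> (\<lambda>x. f x + g x * e) q = SB_lborel \<nu> f q + SB_lborel \<nu> g q * e" for q
    using SB_kernel_integrable[OF assms(1,2), of q] SB_kernel_integrable[OF assms(1,3), of q]
    by (simp add: SB_lborel_def distrib_left flip: mult.assoc)
  then show ?thesis by (simp add: SB_weighted_def scaleR_add_right)
qed

lemma integral_inner_polarization:
  assumes f: "square_integrable f" and g: "square_integrable g"
  shows "(\<integral>x. inner (f x) (g x) \<partial>lborel) =
    ((\<integral>x. (norm (f x + g x))\<^sup>2 \<partial>lborel) - (\<integral>x. (norm (f x - g x))\<^sup>2 \<partial>lborel)) / 4"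
  unfolding inner_polarization
  using square_integrableD(2)[OF square_integrable_add[OF f g]]
    square_integrableD(2)[OF square_integrable_diff[OF f g]] by simp

text \<open>Right linearity sends g e to the image of g times e, so the isometry, polarized for f
  and g e, matches the two sides in every direction e.\<close>

lemma SB_weighted_inner:
  assumes nu: "\<nu> > 0" and I: "I \<in> imag_units" and f: "square_integrable f" and g: "square_integrable g"
  shows "(\<integral>z. qcnj (SB_weighted \<nu> I g z) * SB_weighted \<nu> I f z \<partial>lborel) =
    (\<integral>x. qcnj (g x) * f x \<partial>lborel)"
proof (rule quat_eqI_inner)
  fix e
  note Wf = SB_weighted_isometry(1)[OF nu I f] and Wg = SB_weighted_isometry(1)[OF nu I g]
  have ge: "square_integrable (\<lambda>x. g x * e)" for e by (rule square_integrable_mult_right[OF g])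
  have n: "(\<integral>z. (norm (SB_weighted \<nu> I f z + SB_weighted \<nu> I g z * e))\<^sup>2 \<partial>lborel) =
    (\<integral>x. (norm (f x + g x * e))\<^sup>2 \<partial>lborel)" for e
    using SB_weighted_isometry(2)[OF nu I square_integrable_add[OF f ge]]
    by (simp add: SB_weighted_add_mult[OF nu f g])
  have "inner (\<integral>z. qcnj (SB_weighted \<nu> I g z) * SB_weighted \<nu> I f z \<partial>lborel) e =
    (\<integral>z. inner (SB_weighted \<nu> I f z) (SB_weighted \<nu> I g z * e) \<partial>lborel)"
    using integrable_qcnj_mult[OF Wf Wg] by (simp flip: inner_qcnj_mult)
  also have "\<dots> = (\<integral>x. inner (f x) (g x * e) \<partial>lborel)"
    \<comment> \<open>The sum in the polarization identity comes from e, the difference from -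
      e.\<close>
    using n[of e] n[of "- e"]
    by (simp add: integral_inner_polarization[OF Wf square_integrable_mult_right[OF Wg]]
        integral_inner_polarization[OF f ge])
  also have "\<dots> = inner (\<integral>x. qcnj (g x) * f x \<partial>lborel) e"
    using integrable_qcnj_mult[OF f g] by (simp flip: inner_qcnj_mult)
  finally show "inner (\<integral>z. qcnj (SB_weighted \<nu> I g z) * SB_weighted \<nu> I f z \<partial>lborel) e =
    inner (\<integral>x. qcnj (g x) * f x \<partial>lborel) e" .
qed

lemma SB_lborel_in_fock_space:
  assumes "\<nu> > 0" "I \<in> imag_units" "square_integrable f"
  shows "SB_lborel \<nu> f \<in> fock_space \<nu> I"
proof -
  note sq = SB_weighted_isometry(1)[OF assms]
  have "integrable lebesgue (\<lambda>z. (norm (SB_weighted \<nu> I f z))\<^sup>2)"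
    using square_integrableD[OF sq] by (subst integrable_completion) auto
  then show ?thesis
    using SB_lborel_slice_regular[OF assms(1,3)] by (simp add: fock_space_def norm_SB_weighted)
qed

lemma fock_inner_SB_lborel:
  assumes nu: "\<nu> > 0" and I: "I \<in> imag_units" and f: "square_integrable f" and g: "square_integrable g"
  shows "fock_inner \<nu> I (SB_lborel \<nu> f) (SB_lborel \<nu> g) = (\<integral>x. qcnj (g x) * f x \<partial>lborel)"
proof -
  note Wf = SB_weighted_isometry(1)[OF nu I f] and Wg = SB_weighted_isometry(1)[OF nu I g]
  have q: "qcnj (r *\<^sub>R p) = r *\<^sub>R qcnj p" for r p by (simp add: quat_eq_iff)
  have "qcnj (SB_lborel \<nu> g (slice_point I z)) * SB_lborel \<nu> f (slice_point I z) *
      of_real (exp (- \<nu> * (norm (slice_point I z))\<^sup>2)) =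
    qcnj (SB_weighted \<nu> I g z) * SB_weighted \<nu> I f z" for z
  proof -
    have "exp (- \<nu> * (norm (slice_point I z))\<^sup>2) =
      exp (- \<nu> * (norm (slice_point I z))\<^sup>2 / 2) * exp (- \<nu> * (norm (slice_point I z))\<^sup>2 / 2)"
      by (simp flip: exp_add)
    then show ?thesis by (simp only: SB_weighted_def q of_real_def) simp
  qed
  then have "fock_inner \<nu> I (SB_lborel \<nu> f) (SB_lborel \<nu> g) =
    (LINT z|lebesgue. qcnj (SB_weighted \<nu> I g z) * SB_weighted \<nu> I f z)"
    by (simp only: fock_inner_def)
  also have "\<dots> = (\<integral>z. qcnj (SB_weighted \<nu> I g z) * SB_weighted \<nu> I f z \<partial>lborel)"
    using borel_measurable_integrable[OF integrable_qcnj_mult[OF Wf Wg]] by (rule integral_completion)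
  also have "\<dots> = (\<integral>x. qcnj (g x) * f x \<partial>lborel)"
    by (rule SB_weighted_inner[OF assms])
  finally show ?thesis .
qed

theorem proposition3p1:
  fixes \<nu> :: real and I :: quat and f g :: "real \<Rightarrow> quat"
  assumes "\<nu> > 0" and "I \<in> imag_units"
    and "f \<in> L2_quat" and "g \<in> L2_quat"
  shows "SB_transform \<nu> f \<in> fock_space \<nu> I \<and> SB_transform \<nu> g \<in> fock_space \<nu> I \<and>
    fock_inner \<nu> I (SB_transform \<nu> f) (SB_transform \<nu> g) = L2_inner f g"
proof -
  obtain f' where f': "square_integrable f'" "AE x in lebesgue. f x = f' x"
    using L2_quat_square_integrable[OF assms(3)] .
  obtain g' where g': "square_integrable g'" "AE x in lebesgue. g x = g' x"
    using L2_quat_square_integrable[OF assms(4)] .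
  show ?thesis
    using SB_lborel_in_fock_space[OF assms(1,2)] fock_inner_SB_lborel[OF assms(1,2)] f' g'
    by (simp add: SB_transform_eq_SB_lborel[OF assms(3) f'] SB_transform_eq_SB_lborel[OF assms(4) g']
        L2_inner_eq_lborel[OF assms(3) f' assms(4) g'])
qed

end
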